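(* There exists $n_0$ such that the following holds for every integer $n \geq n_0$. Let $F$ be any graph on $n$ vertices with no isolated vertices, with minimum degree $\delta(F)=\delta$ and maximum degree $\Delta(F) \leq \sqrt{n}/40$. If $G$ is an $n$-vertex graph containing no subgraph isomorphic to $F$, then $q(G) \leq q(H_{n,\delta})$, with equality if and only if $G \cong H_{n,\delta}$.
   Context: All graphs are finite and simple. For a graph $G$, $Q(G)=D(G)+A(G)$ is the signless Laplacian matrix, where $A(G)$ is the adjacency matrix and $D(G)$ the diagonal matrix of vertex degrees; $q(G)$ denotes the largest eigenvalue of $Q(G)$. For integers $n>k\geq 1$, $H_{n,k} = K_{k-1} \vee (K_{n-k} \cup K_1)$, i.e. the $n$-vertex graph consisting of a clique on $n-1$ vertices together with one additional vertex adjacent to exactly $k-1$ vertices of the clique; here $\vee$ denotes the join and $\cup$ the disjoint union. *)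

theory Defs
  imports Complex_Main "Jordan_Normal_Form.Char_Poly"
begin

definition simple_graph :: "nat \<Rightarrow> (nat \<Rightarrow> nat \<Rightarrow> bool) \<Rightarrow> bool" where
  "simple_graph n E \<longleftrightarrow>
     (\<forall>i j. E i j \<longrightarrow> i < n \<and> j < n \<and> i \<noteq> j) \<and> (\<forall>i j. E i j \<longrightarrow> E j i)"

definition degree :: "(nat \<Rightarrow> nat \<Rightarrow> bool) \<Rightarrow> nat \<Rightarrow> nat" where
  "degree E i = card {j. E i j}"

definition min_degree :: "nat \<Rightarrow> (nat \<Rightarrow> nat \<Rightarrow> bool) \<Rightarrow> nat" where
  "min_degree n E = Min (degree E ` {..<n})"

definition max_degree :: "nat \<Rightarrow> (nat \<Rightarrow> nat \<Rightarrow> bool) \<Rightarrow> nat" where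
  "max_degree n E = Max (degree E ` {..<n})"

definition no_isolated_vertices :: "nat \<Rightarrow> (nat \<Rightarrow> nat \<Rightarrow> bool) \<Rightarrow> bool" where
  "no_isolated_vertices n E \<longleftrightarrow> (\<forall>i<n. \<exists>j. E i j)"

definition contains_subgraph ::
  "nat \<Rightarrow> (nat \<Rightarrow> nat \<Rightarrow> bool) \<Rightarrow> nat \<Rightarrow> (nat \<Rightarrow> nat \<Rightarrow> bool) \<Rightarrow> bool" where
  "contains_subgraph nG G nF F \<longleftrightarrow>
     (\<exists>f. inj_on f {..<nF} \<and> f ` {..<nF} \<subseteq> {..<nG} \<and>
          (\<forall>i<nF. \<forall>j<nF. F i j \<longrightarrow> G (f i) (f j)))"

definition graph_iso :: "nat \<Rightarrow> (nat \<Rightarrow> nat \<Rightarrow> bool) \<Rightarrow> (nat \<Rightarrow> nat \<Rightarrow> bool) \<Rightarrow> bool" where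
  "graph_iso n G H \<longleftrightarrow>
     (\<exists>f. bij_betw f {..<n} {..<n} \<and> (\<forall>i<n. \<forall>j<n. G i j \<longleftrightarrow> H (f i) (f j)))"

definition adjacency_matrix :: "nat \<Rightarrow> (nat \<Rightarrow> nat \<Rightarrow> bool) \<Rightarrow> real mat" where
  "adjacency_matrix n E = mat n n (\<lambda>(i, j). if E i j then 1 else 0)"

definition degree_matrix :: "nat \<Rightarrow> (nat \<Rightarrow> nat \<Rightarrow> bool) \<Rightarrow> real mat" where
  "degree_matrix n E = mat n n (\<lambda>(i, j). if i = j then real (degree E i) else 0)"

definition signless_laplacian :: "nat \<Rightarrow> (nat \<Rightarrow> nat \<Rightarrow> bool) \<Rightarrow> real mat" where
  "signless_laplacian n E = degree_matrix n E + adjacency_matrix n E"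

(* q(G): largest eigenvalue of Q(G) (Q is real symmetric, so all eigenvalues are real) *)
definition q_index :: "nat \<Rightarrow> (nat \<Rightarrow> nat \<Rightarrow> bool) \<Rightarrow> real" where
  "q_index n E = Max {x. eigenvalue (signless_laplacian n E) x}"

(* H_{n,k} = K_{k-1} join (K_{n-k} union K_1): clique on {0..<n-1}, and
   vertex n-1 adjacent exactly to the k-1 vertices 0..k-2 *)
definition H_graph :: "nat \<Rightarrow> nat \<Rightarrow> nat \<Rightarrow> nat \<Rightarrow> bool" where
  "H_graph n k i j \<longleftrightarrow> i < n \<and> j < n \<and> i \<noteq> j \<and>
     ((i < n - 1 \<and> j < n - 1) \<or> (i = n - 1 \<and> j < k - 1) \<or> (j = n - 1 \<and> i < k - 1))"

end

theory Submission
  imports "HOL-Analysis.Function_Topology" "HOL-Library.Discrete_Functions" Defs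
begin

text \<open>Write \<open>k\<close> for the minimum degree of \<open>F\<close> and \<open>R\<close> for the complement of \<open>G\<close>, and suppose that
  \<open>q(G) \<ge> q(H)\<close> for \<open>H = H\<^sub>n\<^sub>,\<^sub>k\<close>. Since \<open>q(H) \<ge> 2n - 4\<close>, the graph \<open>R\<close> has at most \<open>n\<close> edges. If all
  degrees in \<open>R\<close> are at most \<open>4n/5\<close>, then \<open>F\<close> and \<open>R\<close> pack, so \<open>G\<close> contains \<open>F\<close>. Otherwise let \<open>v\<close> have
  larger degree in \<open>R\<close>, let \<open>d\<close> be its degree in \<open>G\<close>, and let \<open>r\<close> be the number of edges of \<open>R\<close> that
  avoid \<open>v\<close>.
  If \<open>d < k\<close>, then \<open>G\<close> is a subgraph of a copy of \<open>H\<close>, and Perron--Frobenius forces equality.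
  If \<open>d \<ge> k + r\<close>, then \<open>F\<close> and \<open>R\<close> pack again.
  In the remaining case a copy of \<open>H\<close> arises from \<open>G\<close> by removing \<open>d - k + 1 \<le> r\<close> edges at \<open>v\<close> and
  adding \<open>r\<close> edges elsewhere. The Perron vector of \<open>G\<close> is nearly constant away from \<open>v\<close> and nearly
  zero at \<open>v\<close>, so this increases the Rayleigh quotient, contradicting \<open>q(G) \<ge> q(H)\<close>.\<close>

section \<open>The variational characterization of \<open>q\<close>\<close>

abbreviation nbhd :: "(nat \<Rightarrow> nat \<Rightarrow> bool) \<Rightarrow> nat \<Rightarrow> nat set" where
  "nbhd E i \<equiv> Collect (E i)"

definition arcs :: "(nat \<Rightarrow> nat \<Rightarrow> bool) \<Rightarrow> (nat \<times> nat) set" where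
  "arcs E = {(i, j). E i j}"

text \<open>The \<open>i\<close>-th coordinate of Q x, with the diagonal term spread over the
  neighbours. Functions stand in for matrix vectors until eigenvalues enter.\<close>

definition qop :: "(nat \<Rightarrow> nat \<Rightarrow> bool) \<Rightarrow> (nat \<Rightarrow> real) \<Rightarrow> nat \<Rightarrow> real" where
  "qop E x i = (\<Sum>j\<in>nbhd E i. x i + x j)"

text \<open>Every edge is counted in both directions, so this is twice the quadratic form of the
  signless Laplacian.\<close>
definition qform :: "(nat \<Rightarrow> nat \<Rightarrow> bool) \<Rightarrow> (nat \<Rightarrow> real) \<Rightarrow> real" where
  "qform E x = (\<Sum>(i, j)\<in>arcs E. (x i + x j)\<^sup>2)"

lemma simple_graphD:
  assumes "simple_graph n E" "E i j"
  shows "i < n" "j < n" "i \<noteq> j" "E j i"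
  using assms unfolding simple_graph_def by blast+

lemma simple_graph_irrefl: "simple_graph n E \<Longrightarrow> \<not> E i i"
  by (auto dest: simple_graphD(3))

lemma nbhd_subset: "simple_graph n E \<Longrightarrow> nbhd E i \<subseteq> {..<n}"
  by (auto dest: simple_graphD)

lemma finite_nbhd: "simple_graph n E \<Longrightarrow> finite (nbhd E i)"
  by (meson finite_lessThan finite_subset nbhd_subset)

lemma arcs_subset: "simple_graph n E \<Longrightarrow> arcs E \<subseteq> {..<n} \<times> {..<n}"
  by (auto simp: arcs_def dest: simple_graphD)

lemma finite_arcs: "simple_graph n E \<Longrightarrow> finite (arcs E)"
  by (rule finite_subset[OF arcs_subset]) auto

lemma sum_arcs:
  assumes "simple_graph n E"
  shows "(\<Sum>(i, j)\<in>arcs E. f i j) = (\<Sum>i<n. \<Sum>j\<in>nbhd E i. f i j)"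
proof -
  have "arcs E = Sigma {..<n} (nbhd E)"
    using simple_graphD[OF assms] by (auto simp: arcs_def)
  then show ?thesis
    using assms by (simp add: sum.Sigma finite_nbhd)
qed

lemma sum_arcs_swap:
  assumes "simple_graph n E"
  shows "(\<Sum>(i, j)\<in>arcs E. f i j) = (\<Sum>(i, j)\<in>arcs E. f j i)"
  by (rule sum.reindex_bij_witness[of _ prod.swap prod.swap])
     (auto simp: arcs_def dest: simple_graphD[OF assms])

lemma degree_le:
  assumes "simple_graph n E"
  shows "Defs.degree E i \<le> n - 1"
proof -
  have "nbhd E i \<subseteq> {..<n} - {i}"
    using simple_graphD(2,3)[OF assms] by auto
  then have *: "card (nbhd E i) \<le> card ({..<n} - {i})"
    by (intro card_mono) auto
  show ?thesis
  proof (cases "i < n")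
    case True
    then show ?thesis using * by (simp add: Defs.degree_def)
  next
    case False
    then have "nbhd E i = {}" using simple_graphD[OF assms] by auto
    then show ?thesis by (simp add: Defs.degree_def)
  qed
qed

lemma qop_eq:
  "qop E x i = real (Defs.degree E i) * x i + (\<Sum>j\<in>nbhd E i. x j)"
  by (simp add: qop_def sum.distrib Defs.degree_def)

text \<open>Reversing all arcs turns the factor \<open>y i\<close> into \<open>y j\<close>, and
  adding both versions symmetrizes the sum. For \<open>y = x\<close> this gives
  \<open>qform\<close>; for general \<open>y\<close> it is the first-order term of a
  perturbation.\<close>

lemma sum_mult_qop:
  assumes "simple_graph n E"
  shows "2 * (\<Sum>i<n. y i * qop E x i) = (\<Sum>(i, j)\<in>arcs E. (x i + x j) * (y i + y j))"
proof -
  have "(\<Sum>i<n. y i * qop E x i) = (\<Sum>(i, j)\<in>arcs E. y i * (x i + x j))"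
    by (simp add: sum_arcs[OF assms] qop_def sum_distrib_left)
  moreover have "\<dots> = (\<Sum>(i, j)\<in>arcs E. y j * (x i + x j))"
    by (subst sum_arcs_swap[OF assms]) (simp add: add.commute)
  ultimately have "2 * (\<Sum>i<n. y i * qop E x i) =
      (\<Sum>(i, j)\<in>arcs E. y i * (x i + x j)) + (\<Sum>(i, j)\<in>arcs E. y j * (x i + x j))"
    by simp
  also have "\<dots> = (\<Sum>(i, j)\<in>arcs E. (x i + x j) * (y i + y j))"
    unfolding sum.distrib[symmetric] by (intro sum.cong) (auto simp: algebra_simps)
  finally show ?thesis .
qed

lemma qform_eigenvector:
  assumes "simple_graph n E" "\<And>i. i < n \<Longrightarrow> qop E x i = k * x i"
  shows "qform E x = 2 * k * (\<Sum>i<n. (x i)\<^sup>2)"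
proof -
  have "qform E x = 2 * (\<Sum>i<n. x i * qop E x i)"
    by (simp add: sum_mult_qop[OF assms(1)] qform_def power2_eq_square)
  also have "\<dots> = 2 * (\<Sum>i<n. k * (x i)\<^sup>2)"
    using assms(2) by (simp add: power2_eq_square algebra_simps)
  finally show ?thesis by (simp add: sum_distrib_left algebra_simps)
qed

lemma qform_add_scaled:
  assumes "simple_graph n E"
  shows "qform E (\<lambda>i. x i + t * y i) =
    qform E x + 4 * t * (\<Sum>i<n. y i * qop E x i) + t\<^sup>2 * qform E y"
proof -
  have "qform E (\<lambda>i. x i + t * y i) = (\<Sum>(i, j)\<in>arcs E.
      (x i + x j)\<^sup>2 + 2 * t * ((x i + x j) * (y i + y j)) + t\<^sup>2 * (y i + y j)\<^sup>2)"
    unfolding qform_def by (intro sum.cong) (auto simp: power2_eq_square algebra_simps)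
  also have "\<dots> = qform E x + 2 * t * (2 * (\<Sum>i<n. y i * qop E x i)) + t\<^sup>2 * qform E y"
    unfolding sum_mult_qop[OF assms] qform_def
    by (simp add: sum.distrib sum_distrib_left case_prod_unfold)
  finally show ?thesis by simp
qed

lemma qform_scale: "qform E (\<lambda>i. c * x i) = c\<^sup>2 * qform E x"
  unfolding qform_def sum_distrib_left
  by (intro sum.cong) (auto simp: power2_eq_square algebra_simps)

lemma qform_cong:
  assumes "simple_graph n E" "\<And>i. i < n \<Longrightarrow> x i = y i"
  shows "qform E x = qform E y"
  unfolding qform_def arcs_def
  by (intro sum.cong) (auto simp: assms(2) simple_graphD[OF assms(1)])

text \<open>Entries of opposite sign cancel in \<open>x i + x j\<close>. Absolute values keep the
  norm, so a maximizer can be taken nonnegative.\<close>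

lemma qform_abs_ge:
  "qform E x \<le> qform E (\<lambda>i. \<bar>x i\<bar>)"
  unfolding qform_def
proof (intro sum_mono)
  fix p :: "nat \<times> nat"
  obtain i j where p: "p = (i, j)" by fastforce
  have "\<bar>x i + x j\<bar> \<le> \<bar>\<bar>x i\<bar> + \<bar>x j\<bar>\<bar>" by linarith
  then show "(case p of (i, j) \<Rightarrow> (x i + x j)\<^sup>2) \<le> (case p of (i, j) \<Rightarrow> (\<bar>x i\<bar> + \<bar>x j\<bar>)\<^sup>2)"
    by (simp only: p prod.case abs_le_square_iff)
qed

text \<open>First variation: moving \<open>x\<close> by \<open>t\<close> times the residual Q x - k
  x gains \<open>4 * t * Y\<close>, where \<open>Y\<close> is the squared norm of the residual. For
  small \<open>t\<close> the quadratic term cannot compensate unless \<open>Y\<close> is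
  zero.\<close>

lemma qop_of_maximizer:
  assumes g: "simple_graph n E"
    and bound: "\<And>y. qform E y \<le> 2 * k * (\<Sum>i<n. (y i)\<^sup>2)"
    and eq: "qform E x = 2 * k * (\<Sum>i<n. (x i)\<^sup>2)"
    and "i < n"
  shows "qop E x i = k * x i"
proof -
  define y where "y i = qop E x i - k * x i" for i
  define Y where "Y = (\<Sum>i<n. (y i)\<^sup>2)"
  define C where "C = 2 * k * Y - qform E y"
  have *: "4 * t * Y \<le> t\<^sup>2 * C" for t
  proof -
    have s: "(\<Sum>i<n. (x i + t * y i)\<^sup>2) =
        (\<Sum>i<n. (x i)\<^sup>2) + 2 * t * (\<Sum>i<n. y i * x i) + t\<^sup>2 * Y"
      unfolding Y_def sum_distrib_left sum.distrib[symmetric]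
      by (intro sum.cong) (auto simp: power2_eq_square algebra_simps)
    have "Y = (\<Sum>i<n. y i * qop E x i) - k * (\<Sum>i<n. y i * x i)"
      unfolding Y_def sum_distrib_left sum_subtractf[symmetric]
      by (intro sum.cong) (auto simp: y_def power2_eq_square algebra_simps)
    then have Y: "(\<Sum>i<n. y i * qop E x i) = Y + k * (\<Sum>i<n. y i * x i)" by simp
    have "qform E x + 4 * t * (\<Sum>i<n. y i * qop E x i) + t\<^sup>2 * qform E y \<le>
        2 * k * ((\<Sum>i<n. (x i)\<^sup>2) + 2 * t * (\<Sum>i<n. y i * x i) + t\<^sup>2 * Y)"
      using bound[of "\<lambda>i. x i + t * y i"] unfolding s qform_add_scaled[OF g] .
    then show ?thesis
      unfolding C_def eq Y by (simp add: algebra_simps)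
  qed
  have "Y \<le> 0"
  proof (rule ccontr)
    assume "\<not> Y \<le> 0"
    then have Y: "Y > 0" by simp
    \<comment> \<open>Chosen so that \<open>t * C\<close> is at most \<open>Y\<close>, against
      \<open>4 * Y \<le> t * C\<close>; adding 1 avoids a zero denominator.\<close>
    define t where "t = Y / (\<bar>C\<bar> + 1)"
    have t: "t > 0" unfolding t_def using Y by (intro divide_pos_pos) auto
    have "4 * Y \<le> t * C" using *[of t] t by (simp add: power2_eq_square)
    also have "\<dots> \<le> t * (\<bar>C\<bar> + 1)" using t by (intro mult_left_mono) auto
    also have "\<dots> = Y" unfolding t_def by simp
    finally show False using Y by simp
  qed
  moreover have "(y i)\<^sup>2 \<le> Y"
    unfolding Y_def using \<open>i < n\<close> by (intro member_le_sum) auto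
  ultimately have "y i = 0"
    by (metis order.trans power2_less_eq_zero_iff)
  then show ?thesis by (simp add: y_def)
qed

section \<open>Existence of a nonnegative maximizer\<close>

lemma compact_unit_sphere_coordinates:
  "compact {x :: nat \<Rightarrow> real. (\<forall>i\<ge>n. x i = 0) \<and> (\<Sum>i<n. (x i)\<^sup>2) = 1}"
proof -
  \<comment> \<open>With the coordinates from \<open>n\<close> on pinned to zero, the cube is a
    product of compact sets, so Tychonoff's theorem gives compactness in the function space.\<close>
  define T :: "(nat \<Rightarrow> real) set" where
    "T = (\<Pi>\<^sub>E i\<in>UNIV. if i < n then {-1..1} else {0})"
  have "compact T"
    unfolding T_def compactin_euclidean_iff[symmetric] euclidean_product_topology[symmetric]
    by (subst compactin_PiE) auto
  moreover have "closed {x :: nat \<Rightarrow> real. (\<Sum>i<n. (x i)\<^sup>2) = 1}"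
    by (intro closed_Collect_eq continuous_intros continuous_on_product_coordinates)
  ultimately have "compact (T \<inter> {x. (\<Sum>i<n. (x i)\<^sup>2) = 1})"
    by (rule compact_Int_closed)
  moreover have "T \<inter> {x. (\<Sum>i<n. (x i)\<^sup>2) = 1} =
      {x. (\<forall>i\<ge>n. x i = 0) \<and> (\<Sum>i<n. (x i)\<^sup>2) = 1}"
  proof -
    have "\<bar>x i\<bar> \<le> 1" if "(\<Sum>i<n. (x i)\<^sup>2) = 1" "i < n" for x :: "nat \<Rightarrow> real" and i
    proof -
      have "(x i)\<^sup>2 \<le> (\<Sum>i<n. (x i)\<^sup>2)"
        using that by (intro member_le_sum) auto
      then show ?thesis using that by (simp add: abs_square_le_1)
    qed
    then show ?thesis
      unfolding T_def by (fastforce simp: PiE_iff abs_le_iff split: if_splits)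
  qed
  ultimately show ?thesis by simp
qed

lemma qform_maximizer:
  assumes g: "simple_graph n E" and "0 < n"
  shows "\<exists>x k. (\<forall>i. 0 \<le> x i) \<and> (\<Sum>i<n. (x i)\<^sup>2) = 1 \<and>
    (\<forall>i<n. qop E x i = k * x i) \<and> (\<forall>y. qform E y \<le> 2 * k * (\<Sum>i<n. (y i)\<^sup>2))"
proof -
  define S :: "(nat \<Rightarrow> real) set" where
    "S = {x. (\<forall>i\<ge>n. x i = 0) \<and> (\<Sum>i<n. (x i)\<^sup>2) = 1}"
  have "(\<lambda>i. if i = 0 then 1 else 0) \<in> S"
    using \<open>0 < n\<close> by (auto simp: S_def if_distrib[of "\<lambda>x. x\<^sup>2"] sum.delta cong: if_cong)
  then have "S \<noteq> {}" by blast
  moreover have "compact S"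
    unfolding S_def by (rule compact_unit_sphere_coordinates)
  moreover have "continuous_on S (qform E)"
    unfolding qform_def case_prod_unfold
    by (intro continuous_intros continuous_on_subset[OF continuous_on_product_coordinates]) auto
  ultimately obtain z where z: "z \<in> S" "\<And>y. y \<in> S \<Longrightarrow> qform E y \<le> qform E z"
    using continuous_attains_sup by metis
  \<comment> \<open>Half the maximum, because \<open>qform\<close> counts every edge twice.\<close>
  define k where "k = qform E z / 2"
  have bound: "qform E y \<le> 2 * k * (\<Sum>i<n. (y i)\<^sup>2)" for y
  proof (cases "(\<Sum>i<n. (y i)\<^sup>2) = 0")
    case True
    then have "y i = 0" if "i < n" for i
      using that by (subst (asm) sum_nonneg_eq_0_iff) auto
    then have "qform E y = qform E (\<lambda>i. 0 * y i)"
      by (intro qform_cong[OF g]) auto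
    then show ?thesis using True by (simp add: qform_def)
  next
    case False
    define s where "s = (\<Sum>i<n. (y i)\<^sup>2)"
    have s: "s > 0"
      using False unfolding s_def by (smt (verit) sum_nonneg zero_le_power2)
    \<comment> \<open>Normalizing \<open>y\<close> and erasing the coordinates that the form does
      not see yields a point of \<open>S\<close>.\<close>
    define w where "w i = (if i < n then inverse (sqrt s) * y i else 0)" for i
    have "(\<Sum>i<n. (w i)\<^sup>2) = inverse s * s"
      unfolding s_def sum_distrib_left
      using s by (intro sum.cong) (auto simp: w_def s_def[symmetric] power_mult_distrib power_inverse)
    then have "w \<in> S" using s by (auto simp: S_def w_def)
    moreover have "qform E w = inverse s * qform E y"
    proof -
      have "qform E w = qform E (\<lambda>i. inverse (sqrt s) * y i)"
        by (intro qform_cong[OF g]) (auto simp: w_def)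
      then show ?thesis using s by (simp add: qform_scale power_inverse)
    qed
    ultimately have "inverse s * qform E y \<le> 2 * k"
      using z(2)[of w] by (simp add: k_def)
    then show ?thesis
      using s by (simp add: s_def[symmetric] field_simps)
  qed
  define x where "x i = \<bar>z i\<bar>" for i
  have norm: "(\<Sum>i<n. (x i)\<^sup>2) = 1" using z(1) by (simp add: x_def S_def)
  have "2 * k \<le> qform E x"
    using qform_abs_ge[of E z] by (simp add: x_def[abs_def] k_def)
  then have "qform E x = 2 * k * (\<Sum>i<n. (x i)\<^sup>2)"
    using bound[of x] norm by simp
  then have "qop E x i = k * x i" if "i < n" for i
    using qop_of_maximizer[OF g bound] that by blast
  then show ?thesis
    using norm bound by (intro exI[of _ x] exI[of _ k]) (simp add: x_def)
qed

section \<open>From functions to matrix eigenvalues\<close>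

lemma eigenvalue_signless_laplacian_iff:
  assumes g: "simple_graph n E"
  shows "eigenvalue (signless_laplacian n E) k \<longleftrightarrow>
    (\<exists>x. (\<exists>i<n. x i \<noteq> 0) \<and> (\<forall>i<n. qop E x i = k * x i))"
proof -
  have entry: "(signless_laplacian n E *\<^sub>v vec n x) $ i = qop E x i" if "i < n" for x i
  proof -
    have "(signless_laplacian n E *\<^sub>v vec n x) $ i =
        (\<Sum>j<n. (if i = j then real (Defs.degree E i) * x j else 0) + (if E i j then x j else 0))"
      using that by (auto simp: signless_laplacian_def degree_matrix_def adjacency_matrix_def
          scalar_prod_def algebra_simps atLeast0LessThan intro!: sum.cong)
    also have "\<dots> = real (Defs.degree E i) * x i + (\<Sum>j<n. if E i j then x j else 0)"
      using that by (simp add: sum.distrib)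
    also have "(\<Sum>j<n. if E i j then x j else 0) = (\<Sum>j\<in>{..<n} \<inter> nbhd E i. x j)"
      by (subst sum.inter_restrict) auto
    also have "{..<n} \<inter> nbhd E i = nbhd E i"
      using nbhd_subset[OF g] by blast
    finally show ?thesis by (simp add: qop_eq)
  qed
  have dims: "dim_row (signless_laplacian n E) = n"
    by (simp add: signless_laplacian_def adjacency_matrix_def)
  show ?thesis
  proof
    assume "eigenvalue (signless_laplacian n E) k"
    then obtain v where v: "v \<in> carrier_vec n" "v \<noteq> 0\<^sub>v n"
      "signless_laplacian n E *\<^sub>v v = k \<cdot>\<^sub>v v"
      unfolding eigenvalue_def eigenvector_def dims by blast
    then have "v = vec n (($) v)" by auto
    then have "qop E (($) v) i = k * v $ i" if "i < n" for i
      using entry[OF that, of "($) v"] v that by simp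
    moreover have "\<exists>i<n. v $ i \<noteq> 0"
      using v by (metis carrier_vecD eq_vecI index_zero_vec)
    ultimately show "\<exists>x. (\<exists>i<n. x i \<noteq> 0) \<and> (\<forall>i<n. qop E x i = k * x i)" by blast
  next
    assume "\<exists>x. (\<exists>i<n. x i \<noteq> 0) \<and> (\<forall>i<n. qop E x i = k * x i)"
    then obtain x i where x: "i < n" "x i \<noteq> 0" "\<forall>i<n. qop E x i = k * x i" by blast
    have "signless_laplacian n E *\<^sub>v vec n x = k \<cdot>\<^sub>v vec n x"
      using x entry dims by (intro eq_vecI) auto
    moreover have "vec n x \<noteq> 0\<^sub>v n"
      using x by (metis index_vec index_zero_vec(1))
    ultimately show "eigenvalue (signless_laplacian n E) k"
      unfolding eigenvalue_def eigenvector_def dims by (intro exI[of _ "vec n x"]) auto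
  qed
qed

text \<open>Testing the bound on an eigenvector of any eigenvalue \<open>r\<close> gives
  \<open>r \<le> k\<close>, so an attained Rayleigh bound is the largest eigenvalue.\<close>

lemma q_index_eqI:
  assumes g: "simple_graph n E"
    and bound: "\<And>y. qform E y \<le> 2 * k * (\<Sum>i<n. (y i)\<^sup>2)"
    and "eigenvalue (signless_laplacian n E) k"
  shows "q_index n E = k"
proof -
  have "r \<le> k" if "eigenvalue (signless_laplacian n E) r" for r
  proof -
    obtain x i where x: "i < n" "x i \<noteq> 0" "\<forall>i<n. qop E x i = r * x i"
      using \<open>eigenvalue _ r\<close> unfolding eigenvalue_signless_laplacian_iff[OF g] by blast
    have "0 < (x i)\<^sup>2" using x by simp
    also have "\<dots> \<le> (\<Sum>i<n. (x i)\<^sup>2)" using x by (intro member_le_sum) auto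
    finally have "0 < (\<Sum>i<n. (x i)\<^sup>2)" .
    moreover have "2 * r * (\<Sum>i<n. (x i)\<^sup>2) \<le> 2 * k * (\<Sum>i<n. (x i)\<^sup>2)"
      using bound[of x] qform_eigenvector[OF g, of x r] x by simp
    ultimately show ?thesis by simp
  qed
  \<comment> \<open>\<open>Max\<close> requires a finite set; the eigenvalues are roots of a monic
    polynomial.\<close>
  moreover have "finite {x. eigenvalue (signless_laplacian n E) x}"
  proof -
    have m: "signless_laplacian n E \<in> carrier_mat n n"
      by (simp add: signless_laplacian_def adjacency_matrix_def degree_matrix_def)
    have "char_poly (signless_laplacian n E) \<noteq> 0"
      using degree_monic_char_poly[OF m] by auto
    then show ?thesis
      using poly_roots_finite by (simp add: eigenvalue_root_char_poly[OF m])
  qed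
  ultimately show ?thesis
    unfolding q_index_def using assms(3) by (intro Max_eqI) auto
qed

lemma q_index_rayleigh:
  assumes "simple_graph n E" "0 < n"
  shows "\<exists>x. (\<forall>i. 0 \<le> x i) \<and> (\<Sum>i<n. (x i)\<^sup>2) = 1 \<and>
    (\<forall>i<n. qop E x i = q_index n E * x i) \<and>
    (\<forall>y. qform E y \<le> 2 * q_index n E * (\<Sum>i<n. (y i)\<^sup>2))"
proof -
  obtain x k where x: "\<forall>i. 0 \<le> x i" "(\<Sum>i<n. (x i)\<^sup>2) = 1"
    "\<forall>i<n. qop E x i = k * x i"
    "\<forall>y. qform E y \<le> 2 * k * (\<Sum>i<n. (y i)\<^sup>2)"
    using qform_maximizer[OF assms] by (elim exE conjE) (rule that)
  have "\<exists>i<n. x i \<noteq> 0"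
  proof (rule ccontr)
    assume "\<not> (\<exists>i<n. x i \<noteq> 0)"
    then have "(\<Sum>i<n. (x i)\<^sup>2) = 0" by simp
    then show False using x(2) by simp
  qed
  then have "eigenvalue (signless_laplacian n E) k"
    unfolding eigenvalue_signless_laplacian_iff[OF assms(1)] using x by blast
  then have "q_index n E = k"
    using q_index_eqI[OF assms(1)] x(4) by blast
  then show ?thesis using x by (intro exI[of _ x]) simp
qed

lemma qform_le_q_index:
  assumes "simple_graph n E" "0 < n"
  shows "qform E y \<le> 2 * q_index n E * (\<Sum>i<n. (y i)\<^sup>2)"
proof -
  have "\<forall>y. qform E y \<le> 2 * q_index n E * (\<Sum>i<n. (y i)\<^sup>2)"
    using q_index_rayleigh[OF assms] by (elim exE conjE)
  then show ?thesis by (rule spec)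
qed

lemma q_index_eigenvector:
  assumes "simple_graph n E" "0 < n"
  obtains x where "\<And>i. 0 \<le> x i" "(\<Sum>i<n. (x i)\<^sup>2) = 1"
    "\<And>i. i < n \<Longrightarrow> qop E x i = q_index n E * x i"
  using q_index_rayleigh[OF assms] by blast

section \<open>Spectral comparison with \<open>H\<^sub>n\<^sub>,\<^sub>k\<close>\<close>

text \<open>A copy of \<open>H_graph\<close> when \<open>S\<close> has \<open>k - 1\<close> elements
  and avoids \<open>v\<close>. Keeping \<open>v\<close> and \<open>S\<close> free allows arc-by-arc
  comparison with \<open>G\<close> on the labels of \<open>G\<close>.\<close>

definition pendant_clique :: "nat \<Rightarrow> nat \<Rightarrow> nat set \<Rightarrow> nat \<Rightarrow> nat \<Rightarrow> bool" where
  "pendant_clique n v S i j \<longleftrightarrow>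
     i < n \<and> j < n \<and> i \<noteq> j \<and> (i = v \<longrightarrow> j \<in> S) \<and> (j = v \<longrightarrow> i \<in> S)"

lemma simple_graph_pendant_clique: "simple_graph n (pendant_clique n v S)"
  by (auto simp: simple_graph_def pendant_clique_def)

lemma simple_graph_H_graph: "simple_graph n (H_graph n k)"
  by (auto simp: simple_graph_def H_graph_def)

lemma graph_iso_sym:
  assumes "graph_iso n G H"
  shows "graph_iso n H G"
proof -
  obtain f where f: "bij_betw f {..<n} {..<n}" "\<And>i j. i < n \<Longrightarrow> j < n \<Longrightarrow> G i j \<longleftrightarrow> H (f i) (f j)"
    using assms unfolding graph_iso_def by blast
  let ?g = "inv_into {..<n} f"
  have "bij_betw ?g {..<n} {..<n}"
    using f(1) by (rule bij_betw_inv_into)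
  moreover have "H i j \<longleftrightarrow> G (?g i) (?g j)" if "i < n" "j < n" for i j
  proof -
    have "?g i < n" "?g j < n"
      using calculation that by (auto dest: bij_betwE)
    moreover have "f (?g i) = i" "f (?g j) = j"
      using f(1) that by (auto simp: bij_betw_inv_into_right)
    ultimately show ?thesis using f(2)[of "?g i" "?g j"] by simp
  qed
  ultimately show ?thesis unfolding graph_iso_def by blast
qed

lemma graph_iso_pendant_clique:
  assumes "v < n" "S \<subseteq> {..<n} - {v}" "card S = k - 1"
  shows "graph_iso n (pendant_clique n v S) (H_graph n k)"
proof -
  let ?T = "{..<n} - {v} - S"
  have finS: "finite S" using assms(2) by (rule finite_subset) auto
  have cardT: "card ?T = n - 1 - (k - 1)"
    using assms finS by (simp add: card_Diff_subset)
  have le: "k - 1 \<le> n - 1"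
    using card_mono[OF _ assms(2)] assms by simp
  obtain f where f: "bij_betw f S {..<k - 1}"
    using finite_same_card_bij[of S "{..<k - 1}"] finS assms(3) by auto
  obtain h where h: "bij_betw h ?T {k - 1..<n - 1}"
    using finite_same_card_bij[of ?T "{k - 1..<n - 1}"] cardT by auto
  \<comment> \<open>The exceptional vertex goes last, \<open>S\<close> fills the first
    \<open>k - 1\<close> labels, and the remaining clique vertices fill the interval
    between.\<close>
  define p where "p i = (if i = v then n - 1 else if i \<in> S then f i else h i)" for i
  have bS: "bij_betw p S {..<k - 1}"
    using f by (rule bij_betw_cong[THEN iffD1, rotated]) (use assms(2) in \<open>auto simp: p_def\<close>)
  have bT: "bij_betw p ?T {k - 1..<n - 1}"
    using h by (rule bij_betw_cong[THEN iffD1, rotated]) (auto simp: p_def)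
  have bv: "bij_betw p {v} {n - 1}"
    by (simp add: p_def)
  have "bij_betw p (S \<union> ?T) ({..<k - 1} \<union> {k - 1..<n - 1})"
    using bS bT by (rule bij_betw_combine) auto
  then have "bij_betw p (S \<union> ?T \<union> {v}) ({..<k - 1} \<union> {k - 1..<n - 1} \<union> {n - 1})"
    using bv by (rule bij_betw_combine) (use le in auto)
  moreover have "S \<union> ?T \<union> {v} = {..<n}" using assms by auto
  moreover have "{..<k - 1} \<union> {k - 1..<n - 1} \<union> {n - 1} = {..<n}"
    using le assms(1) by auto
  ultimately have p: "bij_betw p {..<n} {..<n}" by simp
  have pinj: "p i = p j \<longleftrightarrow> i = j" if "i < n" "j < n" for i j
    using p that by (auto simp: bij_betw_def inj_on_def)
  have pv: "p i = n - 1 \<longleftrightarrow> i = v" if "i < n" for i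
    using pinj[OF that assms(1)] by (simp add: p_def)
  have pS: "p i < k - 1 \<longleftrightarrow> i \<in> S" if "i < n" for i
  proof
    assume "p i < k - 1"
    then have "p i \<in> p ` S" using bS by (simp add: bij_betw_def)
    then obtain s where s: "s \<in> S" "p i = p s" by blast
    then show "i \<in> S" using pinj[of i s] that assms(2) by auto
  next
    show "i \<in> S \<Longrightarrow> p i < k - 1"
      using bS by (auto dest: bij_betwE)
  qed
  have pn: "p i < n" if "i < n" for i
    using p that by (auto dest: bij_betwE)
  have plt: "p i < n - 1 \<longleftrightarrow> i \<noteq> v" if "i < n" for i
    using pn[OF that] pv[OF that] by linarith
  have vS: "v \<notin> S" using assms(2) by blast
  have "pendant_clique n v S i j \<longleftrightarrow> H_graph n k (p i) (p j)" if "i < n" "j < n" for i j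
    unfolding pendant_clique_def H_graph_def plt[OF that(1)] plt[OF that(2)]
      pv[OF that(1)] pv[OF that(2)] pS[OF that(1)] pS[OF that(2)] pinj[OF that]
    using that vS pn by blast
  then show ?thesis
    unfolding graph_iso_def using p by blast
qed

text \<open>The Perron vector of \<open>G\<close>, transported along \<open>f\<close>, is a test
  vector for \<open>H\<close>; further arcs of \<open>H\<close> only add squares.\<close>

lemma q_index_mono:
  assumes G: "simple_graph n G" and H: "simple_graph n H" and "0 < n"
    and f: "bij_betw f {..<n} {..<n}"
    and sub: "\<And>i j. G i j \<Longrightarrow> H (f i) (f j)"
  shows "q_index n G \<le> q_index n H"
proof -
  obtain x where x: "\<And>i. 0 \<le> x i" "(\<Sum>i<n. (x i)\<^sup>2) = 1"
    "\<And>i. i < n \<Longrightarrow> qop G x i = q_index n G * x i"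
    using q_index_eigenvector[OF G \<open>0 < n\<close>] by blast
  define y where "y = x \<circ> inv_into {..<n} f"
  have yf: "y (f i) = x i" if "i < n" for i
    using that f by (simp add: y_def bij_betw_inv_into_left)
  have ny: "(\<Sum>i<n. (y i)\<^sup>2) = 1"
    using sum.reindex_bij_betw[OF f, of "\<lambda>i. (y i)\<^sup>2"] x(2) by (simp add: yf)
  have inj: "inj_on (\<lambda>(i, j). (f i, f j)) (arcs G)"
  proof -
    have "inj_on (map_prod f f) ({..<n} \<times> {..<n})"
      using f by (intro map_prod_inj_on) (auto simp: bij_betw_def)
    then show ?thesis
      using arcs_subset[OF G] by (simp add: map_prod_def inj_on_subset)
  qed
  have "2 * q_index n G = qform G x"
    using qform_eigenvector[OF G x(3)] x(2) by simp
  also have "\<dots> = (\<Sum>p\<in>arcs G. (\<lambda>(i, j). (y i + y j)\<^sup>2) (case p of (i, j) \<Rightarrow> (f i, f j)))"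
    unfolding qform_def
    using simple_graphD(1,2)[OF G] by (intro sum.cong) (auto simp: yf arcs_def)
  also have "\<dots> = (\<Sum>(i, j)\<in>(\<lambda>(i, j). (f i, f j)) ` arcs G. (y i + y j)\<^sup>2)"
    by (subst sum.reindex[OF inj]) simp
  also have "\<dots> \<le> qform H y"
    unfolding qform_def
    by (intro sum_mono2 finite_arcs[OF H]) (auto simp: arcs_def sub)
  also have "\<dots> \<le> 2 * q_index n H"
    using qform_le_q_index[OF H \<open>0 < n\<close>, of y] ny by simp
  finally show ?thesis by simp
qed

lemma q_index_iso:
  assumes G: "simple_graph n G" and H: "simple_graph n H" and "0 < n" and "graph_iso n G H"
  shows "q_index n G = q_index n H"
proof -
  have "q_index n G \<le> q_index n H"
    if G: "simple_graph n G" and H: "simple_graph n H" and iso: "graph_iso n G H" for G H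
  proof -
    obtain f where f: "bij_betw f {..<n} {..<n}" "\<And>i j. i < n \<Longrightarrow> j < n \<Longrightarrow> G i j \<longleftrightarrow> H (f i) (f j)"
      using iso unfolding graph_iso_def by blast
    show ?thesis
      by (rule q_index_mono[OF G H \<open>0 < n\<close> f(1)]) (use f(2) simple_graphD[OF G] in blast)
  qed
  then show ?thesis
    using assms graph_iso_sym by (meson order.antisym)
qed

text \<open>The indicator of the clique on \<open>n - 1\<close> vertices is the test vector; that
  clique alone has q equal to 2(n - 2), so the bound is independent of \<open>S\<close>.\<close>

lemma q_index_pendant_clique_ge:
  assumes "v < n" "2 \<le> n"
  shows "2 * real n - 4 \<le> q_index n (pendant_clique n v S)"
proof -
  let ?K = "pendant_clique n v S"
  note K = simple_graph_pendant_clique[of n v S]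
  define y where "y i = (if i = v then 0 else 1 :: real)" for i
  have card_v: "card ({..<n} - {v}) = n - 1" using assms by simp
  have "(\<Sum>i<n. (y i)\<^sup>2) = (\<Sum>i\<in>{..<n} - {v}. 1)"
    by (rule sum.mono_neutral_cong_right) (auto simp: y_def)
  then have ny: "(\<Sum>i<n. (y i)\<^sup>2) = real (n - 1)" using card_v by simp
  have "real (n - 1) * (4 * real (n - 2)) = (\<Sum>i\<in>{..<n} - {v}. 4 * real (n - 2))"
    using card_v by simp
  also have "\<dots> \<le> (\<Sum>i\<in>{..<n} - {v}. \<Sum>j\<in>nbhd ?K i. (y i + y j)\<^sup>2)"
  proof (rule sum_mono)
    fix i assume i: "i \<in> {..<n} - {v}"
    have "4 * real (n - 2) = (\<Sum>j\<in>{..<n} - {v, i}. (y i + y j)\<^sup>2)"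
      using i assms by (simp add: y_def card_Diff_subset)
    also have "\<dots> \<le> (\<Sum>j\<in>nbhd ?K i. (y i + y j)\<^sup>2)"
      using i by (intro sum_mono2 finite_nbhd[OF K]) (auto simp: pendant_clique_def)
    finally show "4 * real (n - 2) \<le> (\<Sum>j\<in>nbhd ?K i. (y i + y j)\<^sup>2)" .
  qed
  also have "\<dots> \<le> (\<Sum>i<n. \<Sum>j\<in>nbhd ?K i. (y i + y j)\<^sup>2)"
    by (intro sum_mono2) (auto intro: sum_nonneg)
  also have "\<dots> = qform ?K y"
    unfolding qform_def sum_arcs[OF K] ..
  also have "\<dots> \<le> 2 * q_index n ?K * real (n - 1)"
    using qform_le_q_index[OF K, of y] assms unfolding ny by simp
  finally have "real (n - 1) * (4 * real (n - 2)) \<le> real (n - 1) * (2 * q_index n ?K)"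
    by (simp add: mult_ac)
  then have "4 * real (n - 2) \<le> 2 * q_index n ?K"
    using assms by (subst (asm) mult_le_cancel_left_pos) auto
  then show ?thesis using assms by (simp add: of_nat_diff)
qed

text \<open>If an edge of the clique with a pendant vertex were missing, its endpoints would be zeros of
  a nonnegative eigenvector of the latter, and by the eigenvalue equation the whole vector would
  vanish.\<close>
lemma subgraph_pendant_clique_eq:
  assumes G: "simple_graph n G" and v: "v < n" "S \<subseteq> {..<n} - {v}"
    and S: "real (card S) < 2 * real n - 4"
    and sub: "\<And>i j. G i j \<Longrightarrow> pendant_clique n v S i j"
    and ge: "q_index n (pendant_clique n v S) \<le> q_index n G"
  shows "G = pendant_clique n v S"
proof (rule ccontr)
  let ?K = "pendant_clique n v S"
  assume "G \<noteq> ?K"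
  then obtain i j where ij: "?K i j" "\<not> G i j"
    using sub by blast
  note K = simple_graph_pendant_clique[of n v S]
  have n: "0 < n" "2 \<le> n" using v(1) S by auto
  obtain x where x: "\<And>i. 0 \<le> x i" "(\<Sum>i<n. (x i)\<^sup>2) = 1"
    "\<And>i. i < n \<Longrightarrow> qop G x i = q_index n G * x i"
    using q_index_eigenvector[OF G n(1)] by blast
  have sub': "arcs G \<subseteq> arcs ?K" using sub by (auto simp: arcs_def)
  have G2: "qform G x = 2 * q_index n G"
    using qform_eigenvector[OF G x(3)] x(2) by simp
  have split: "qform ?K x = qform G x + (\<Sum>(i, j)\<in>arcs ?K - arcs G. (x i + x j)\<^sup>2)"
    unfolding qform_def using sum.subset_diff[OF sub' finite_arcs[OF K]] by (simp add: add.commute)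
  have Kle: "qform ?K x \<le> 2 * q_index n ?K"
    using qform_le_q_index[OF K n(1), of x] x(2) by simp
  have nn: "0 \<le> (\<Sum>(i, j)\<in>arcs ?K - arcs G. (x i + x j)\<^sup>2)"
    by (intro sum_nonneg) auto
  \<comment> \<open>The assumption \<open>ge\<close> leaves no room for a positive contribution of
    the missing arcs.\<close>
  have "(\<Sum>(i, j)\<in>arcs ?K - arcs G. (x i + x j)\<^sup>2) = 0"
    using split Kle nn G2 ge by linarith
  then have zero_sq: "\<forall>p\<in>arcs ?K - arcs G. (case p of (i, j) \<Rightarrow> (x i + x j)\<^sup>2) = 0"
    by (subst (asm) sum_nonneg_eq_0_iff) (auto simp: finite_arcs[OF K])
  then have "(x i + x j)\<^sup>2 = 0"
    using bspec[OF zero_sq, of "(i, j)"] ij by (simp add: arcs_def)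
  then have "x i = 0" "x j = 0"
    using x(1)[of i] x(1)[of j] by (simp_all add: add_nonneg_eq_0_iff)
  moreover have "i \<noteq> v \<or> j \<noteq> v" "i < n" "j < n"
    using ij by (auto simp: pendant_clique_def)
  \<comment> \<open>At least one endpoint of the missing edge differs from \<open>v\<close>. It is
    adjacent to all other clique vertices, so its eigenvalue equation spreads the zero to
    them.\<close>
  ultimately obtain a where a: "a < n" "a \<noteq> v" "x a = 0" by blast
  \<comment> \<open>Equality in the Rayleigh bound makes \<open>x\<close> an eigenvector of the
    larger graph as well.\<close>
  have "qform ?K x = 2 * q_index n ?K * (\<Sum>i<n. (x i)\<^sup>2)"
    using split Kle nn G2 ge x(2) by simp
  then have eig: "qop ?K x i = q_index n ?K * x i" if "i < n" for i
    using qop_of_maximizer[OF K] qform_le_q_index[OF K n(1)] that by blast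
  have "(\<Sum>j\<in>nbhd ?K a. x j) = 0"
    using eig[OF a(1)] a(3) by (simp add: qop_eq)
  then have zero: "x j = 0" if "?K a j" for j
    using x(1) that by (subst (asm) sum_nonneg_eq_0_iff) (auto simp: finite_nbhd[OF K])
  have zero': "x j = 0" if "j < n" "j \<noteq> v" for j
    using zero[of j] a that by (cases "j = a") (auto simp: pendant_clique_def)
  have nv: "nbhd ?K v = S" using v by (auto simp: pendant_clique_def)
  \<comment> \<open>With zeros everywhere else, a nonzero entry at \<open>v\<close> would make the
    eigenvalue equal to \<open>card S\<close>, which is too small.\<close>
  have "q_index n ?K * x v = real (card S) * x v"
    using eig[OF v(1)] zero' v(2) unfolding qop_eq Defs.degree_def nv
    by (subst (asm) sum.neutral) auto
  moreover have "real (card S) < q_index n ?K"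
    using q_index_pendant_clique_ge[OF v(1) n(2), of S] S by linarith
  ultimately have "x v = 0" by simp
  then have "(\<Sum>i<n. (x i)\<^sup>2) = 0"
    using zero' by (intro sum.neutral) (metis lessThan_iff power_zero_numeral)
  then show False using x(2) by simp
qed

section \<open>Degree sums and entries of the Perron vector\<close>

lemma finite_interval_max:
  fixes f :: "nat \<Rightarrow> real"
  assumes "a < n"
  obtains z where "z < n" "\<And>i. i < n \<Longrightarrow> f i \<le> f z"
proof -
  have "Max (f ` {..<n}) \<in> f ` {..<n}"
    using assms by (intro Max_in) auto
  then obtain z where z: "z < n" "Max (f ` {..<n}) = f z" by auto
  have "f i \<le> f z" if "i < n" for i
    unfolding z(2)[symmetric] using that by (intro Max_ge) auto
  then show ?thesis using that z(1) by blast
qed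

lemma max_entry_pos:
  fixes x :: "nat \<Rightarrow> real"
  assumes "\<And>i. 0 \<le> x i" "(\<Sum>i<n. (x i)\<^sup>2) = 1"
  obtains z where "z < n" "0 < x z" "\<And>i. i < n \<Longrightarrow> x i \<le> x z"
proof -
  have "\<exists>a<n. x a \<noteq> 0"
  proof (rule ccontr)
    assume "\<not> (\<exists>a<n. x a \<noteq> 0)"
    then have "(\<Sum>i<n. (x i)\<^sup>2) = 0" by simp
    then show False using assms(2) by simp
  qed
  then obtain a where a: "a < n" "0 < x a"
    using assms(1) by (metis order.not_eq_order_implies_strict)
  obtain z where z: "z < n" "\<And>i. i < n \<Longrightarrow> x i \<le> x z"
    using finite_interval_max[OF a(1)] by blast
  then show ?thesis using that[of z] a by (meson order.strict_trans2)
qed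

text \<open>The eigenvalue equation is evaluated where the ratio of the eigenvector to the degree is
  largest.\<close>
lemma degree_sum_ge:
  assumes G: "simple_graph n G" and n: "3 \<le> n" and q: "2 * real n - 4 \<le> q_index n G"
  shows "real n * (real n - 3) \<le> (\<Sum>i<n. real (Defs.degree G i))"
proof -
  obtain x where x: "\<And>i. 0 \<le> x i" "(\<Sum>i<n. (x i)\<^sup>2) = 1"
    "\<And>i. i < n \<Longrightarrow> qop G x i = q_index n G * x i"
    using q_index_eigenvector[OF G] n by auto
  define d where "d i = real (Defs.degree G i)" for i
  \<comment> \<open>Division by zero yields 0 at isolated vertices; there \<open>x i\<close>
    vanishes too, so \<open>x i = r i * d i\<close> holds for every vertex.\<close>
  define r where "r i = x i / d i" for i
  have d_le: "d i \<le> real n - 1" for i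
    using degree_le[OF G, of i] n by (simp add: d_def)
  have d_nonneg: "0 \<le> d i" for i by (simp add: d_def)
  have x0: "x i = 0" if "i < n" "d i = 0" for i
  proof -
    have "nbhd G i = {}"
      using that finite_nbhd[OF G] by (simp add: d_def Defs.degree_def)
    then have "qop G x i = 0" by (simp only: qop_def sum.empty)
    then have "q_index n G * x i = 0" using x(3)[OF that(1)] by simp
    then show ?thesis using q n by auto
  qed
  have xr: "x i = r i * d i" if "i < n" for i
    using x0[OF that] by (cases "d i = 0") (auto simp: r_def)
  obtain a where a: "a < n" "0 < x a" using max_entry_pos[OF x(1,2)] by blast
  obtain z where z: "z < n" "\<And>i. i < n \<Longrightarrow> r i \<le> r z"
    using finite_interval_max[OF a(1)] by blast
  have "0 < d a" using x0[OF a(1)] a(2) d_nonneg[of a] by (cases "d a = 0") auto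
  then have "0 < r a" using a by (simp add: r_def)
  then have rz: "0 < r z" using z(2)[OF a(1)] by linarith
  then have dz: "0 < d z" using d_nonneg[of z] by (cases "d z = 0") (auto simp: r_def)
  have "r z * ((q_index n G - d z) * d z) = (\<Sum>j\<in>nbhd G z. x j)"
    using x(3)[OF z(1)] xr[OF z(1)] by (simp add: qop_eq d_def algebra_simps)
  also have "\<dots> \<le> (\<Sum>j\<in>nbhd G z. r z * d j)"
  proof (rule sum_mono)
    fix j assume "j \<in> nbhd G z"
    then have "j < n" using simple_graphD[OF G] by blast
    then show "x j \<le> r z * d j"
      using z(2) xr d_nonneg by (simp add: mult_right_mono)
  qed
  also have "\<dots> = r z * (\<Sum>j\<in>nbhd G z. d j)" by (simp add: sum_distrib_left)
  \<comment> \<open>Cancelling \<open>r z\<close> replaces eigenvector entries by degrees.\<close>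
  finally have main: "(q_index n G - d z) * d z \<le> (\<Sum>j\<in>nbhd G z. d j)"
    using rz by simp
  have "(2 * real n - 4 - d z) * d z \<le> (q_index n G - d z) * d z"
    using q dz by (intro mult_right_mono) auto
  then have main': "(2 * real n - 4 - d z) * d z \<le> (\<Sum>j\<in>nbhd G z. d j)"
    using main by linarith
  \<comment> \<open>Bounding all neighbouring degrees by \<open>n - 1\<close> leaves only three
    possible values of \<open>d z\<close>, from \<open>n - 3\<close> to
    \<open>n - 1\<close>.\<close>
  have "(\<Sum>j\<in>nbhd G z. d j) \<le> (\<Sum>j\<in>nbhd G z. real n - 1)"
    by (intro sum_mono d_le)
  also have "\<dots> = (real n - 1) * d z" by (simp add: d_def Defs.degree_def)
  finally have "(2 * real n - 4 - d z) * d z \<le> (real n - 1) * d z" using main' by linarith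
  then have "2 * real n - 4 - d z \<le> real n - 1" using dz by simp
  then have "n - 3 \<le> Defs.degree G z" using n by (simp add: d_def)
  moreover have "Defs.degree G z \<le> n - 1" by (rule degree_le[OF G])
  ultimately have "Defs.degree G z = n - 3 \<or> Defs.degree G z = n - 2 \<or> Defs.degree G z = n - 1"
    using n by linarith
  then have cases: "d z = real n - 3 \<or> d z = real n - 2 \<or> d z = real n - 1"
    using n by (auto simp: d_def of_nat_diff)
  have "(\<Sum>j\<in>insert z (nbhd G z). d j) \<le> (\<Sum>i<n. d i)"
    using z(1) nbhd_subset[OF G] by (intro sum_mono2) (auto simp: d_nonneg)
  moreover have "z \<notin> nbhd G z" using simple_graphD(3)[OF G] by blast
  ultimately have "d z + (\<Sum>j\<in>nbhd G z. d j) \<le> (\<Sum>i<n. d i)"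
    using finite_nbhd[OF G] by simp
  then have "d z * (2 * real n - 3 - d z) \<le> (\<Sum>i<n. d i)"
    using main' by (simp add: algebra_simps)
  \<comment> \<open>The value \<open>n - 3\<close> gives equality; the other two exceed it by
    2.\<close>
  moreover have "real n * (real n - 3) \<le> d z * (2 * real n - 3 - d z)"
    using cases
  proof (elim disjE)
    assume e: "d z = real n - 3"
    show ?thesis unfolding e by (simp add: algebra_simps)
  next
    assume e: "d z = real n - 2"
    show ?thesis unfolding e by (simp add: algebra_simps)
  next
    assume e: "d z = real n - 1"
    show ?thesis unfolding e by (simp add: algebra_simps)
  qed
  ultimately show ?thesis by (simp add: d_def)
qed

text \<open>In the Perron vector of \<open>G\<close> all entries are close to the maximum, except for the one at
  \<open>v\<close>, which is close to zero. Hence a missing edge away from \<open>v\<close> costs more than an additional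
  edge at \<open>v\<close> contributes.\<close>
lemma q_index_less_pendant_clique:
  assumes G: "simple_graph n G" and v: "v < n" and n: "200 \<le> n"
    and S: "S \<subseteq> nbhd G v"
    and dv: "5 * Defs.degree G v \<le> n"
    and dw: "\<And>w. w < n \<Longrightarrow> w \<noteq> v \<Longrightarrow> 4 / 5 * real n - 2 \<le> real (Defs.degree G w)"
    and card: "card (arcs G - arcs (pendant_clique n v S)) \<le> card (arcs (pendant_clique n v S) - arcs G)"
    and ne: "arcs (pendant_clique n v S) - arcs G \<noteq> {}"
    and q: "2 * real n - 4 \<le> q_index n G"
  shows "q_index n G < q_index n (pendant_clique n v S)"
proof -
  let ?K = "pendant_clique n v S"
  note K = simple_graph_pendant_clique[of n v S]
  obtain x where x: "\<And>i. 0 \<le> x i" "(\<Sum>i<n. (x i)\<^sup>2) = 1"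
    "\<And>i. i < n \<Longrightarrow> qop G x i = q_index n G * x i"
    using q_index_eigenvector[OF G] n by auto
  obtain z where z: "z < n" "0 < x z" "\<And>i. i < n \<Longrightarrow> x i \<le> x z"
    using max_entry_pos[OF x(1,2)] by blast
  define M where "M = x z"
  define q where "q = q_index n G"
  define d where "d i = real (Defs.degree G i)" for i
  define X where "X = (\<Sum>i<n. x i)"
  have M: "0 < M" and xM: "\<And>i. i < n \<Longrightarrow> x i \<le> M"
    using z by (auto simp: M_def)
  have qge: "2 * real n - 4 \<le> q" using \<open>2 * real n - 4 \<le> q_index n G\<close> by (simp add: q_def)
  have eq: "(q - d i) * x i = (\<Sum>j\<in>nbhd G i. x j)" if "i < n" for i
    using x(3)[OF that] by (simp add: qop_eq q_def d_def algebra_simps)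
  have nb_le: "(\<Sum>j\<in>nbhd G i. x j) \<le> d i * M" for i
  proof -
    have "(\<Sum>j\<in>nbhd G i. x j) \<le> (\<Sum>j\<in>nbhd G i. M)"
      using simple_graphD(2)[OF G] by (intro sum_mono xM) auto
    then show ?thesis by (simp add: d_def Defs.degree_def)
  qed
  have d_le: "d i \<le> real n - 1" for i
    using degree_le[OF G, of i] n by (simp add: d_def)
  have "(q - d z) * M \<le> d z * M" using eq[OF z(1)] nb_le[of z] by (simp add: M_def)
  then have "q - d z \<le> d z" using M by simp
  then have q_le: "q \<le> 2 * real n - 2" using d_le[of z] by simp
  \<comment> \<open>The equation at \<open>v\<close> gives a ratio tending to 1/9; 3/25 is slightly
    larger and absorbs the lower-order terms.\<close>
  have xv: "x v \<le> 3 / 25 * M"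
  proof -
    have dv': "d v \<le> real n / 5" using dv by (simp add: d_def)
    have "(9 / 5 * real n - 4) * x v \<le> (q - d v) * x v"
      using qge dv' x(1) by (intro mult_right_mono) auto
    also have "\<dots> \<le> d v * M" using eq[OF v] nb_le[of v] by simp
    also have "\<dots> \<le> real n / 5 * M" using dv' M by (intro mult_right_mono) auto
    also have "\<dots> \<le> (9 / 5 * real n - 4) * (3 / 25 * M)"
      using n M by (simp add: algebra_simps)
    finally show ?thesis using n by (subst (asm) mult_le_cancel_left_pos) auto
  qed
  have zv: "z \<noteq> v" using xv M by (auto simp: M_def)
  \<comment> \<open>At the maximum, the closed neighbourhood of \<open>z\<close> alone carries
    weight \<open>(q - d z + 1) * M\<close>.\<close>
  have X_ge: "(real n - 2) * M \<le> X"
  proof -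
    have "x z + (\<Sum>j\<in>nbhd G z. x j) = (\<Sum>j\<in>insert z (nbhd G z). x j)"
      using finite_nbhd[OF G] simple_graphD(3)[OF G] by (subst sum.insert) auto
    also have "\<dots> \<le> X"
      unfolding X_def using z(1) nbhd_subset[OF G] x(1) by (intro sum_mono2) auto
    finally have "(q - d z + 1) * M \<le> X"
      using eq[OF z(1)] by (simp add: M_def algebra_simps)
    moreover have "(real n - 2) * M \<le> (q - d z + 1) * M"
      using qge d_le[of z] M by (intro mult_right_mono) auto
    ultimately show ?thesis by linarith
  qed
  \<comment> \<open>Outside its closed neighbourhood \<open>w\<close> misses at most
    \<open>n/5 + 1\<close> vertices of weight at most \<open>M\<close>. This gives a ratio tending
    to 2/3, and 13/20 lies below it.\<close>
  have xw: "13 / 20 * M \<le> x w" if w: "w < n" "w \<noteq> v" for w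
  proof -
    have dw': "4 / 5 * real n - 2 \<le> d w" using dw[OF w] by (simp add: d_def)
    let ?A = "insert w (nbhd G w)"
    have A: "?A \<subseteq> {..<n}" using w nbhd_subset[OF G] by auto
    have cA: "card ?A = Defs.degree G w + 1"
      using finite_nbhd[OF G] simple_graphD(3)[OF G] by (subst card_insert_disjoint) (auto simp: Defs.degree_def)
    have "(\<Sum>j\<in>{..<n} - ?A. x j) \<le> (\<Sum>j\<in>{..<n} - ?A. M)"
      by (intro sum_mono xM) auto
    also have "\<dots> = real (n - (Defs.degree G w + 1)) * M"
      using A cA finite_nbhd[OF G] by (simp add: card_Diff_subset)
    also have "\<dots> = (real n - 1 - d w) * M"
      using degree_le[OF G, of w] n by (simp add: of_nat_diff d_def)
    also have "\<dots> \<le> (real n / 5 + 1) * M"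
      using dw' M by (intro mult_right_mono) auto
    finally have rest: "(\<Sum>j\<in>{..<n} - ?A. x j) \<le> (real n / 5 + 1) * M" .
    have "X = (\<Sum>j\<in>{..<n} - ?A. x j) + (\<Sum>j\<in>?A. x j)"
      unfolding X_def by (rule sum.subset_diff[OF A]) auto
    moreover have "(\<Sum>j\<in>?A. x j) = x w + (\<Sum>j\<in>nbhd G w. x j)"
      using finite_nbhd[OF G] simple_graphD(3)[OF G] by (subst sum.insert) auto
    ultimately have "X - (real n / 5 + 1) * M \<le> (q - d w + 1) * x w"
      using rest eq[OF w(1)] by (simp add: algebra_simps)
    also have "\<dots> \<le> (6 / 5 * real n + 1) * x w"
      using dw' q_le x(1) by (intro mult_right_mono) auto
    finally have "(real n - 2) * M - (real n / 5 + 1) * M \<le> (6 / 5 * real n + 1) * x w"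
      using X_ge by linarith
    moreover have "(6 / 5 * real n + 1) * (13 / 20 * M) \<le> (real n - 2) * M - (real n / 5 + 1) * M"
    proof -
      have "(6 / 5 * real n + 1) * 13 / 20 * M \<le> (real n - 2 - (real n / 5 + 1)) * M"
        using n M by (intro mult_right_mono) auto
      then show ?thesis by (simp only: left_diff_distrib mult.assoc)
    qed
    ultimately have "(6 / 5 * real n + 1) * (13 / 20 * M) \<le> (6 / 5 * real n + 1) * x w" by linarith
    then show ?thesis using n by (subst (asm) mult_le_cancel_left_pos) auto
  qed
  \<comment> \<open>Arcs gained avoid \<open>v\<close>, since \<open>S\<close> consists of
    neighbours of \<open>v\<close> in \<open>G\<close>; both ends are at least
    \<open>13/20 * M\<close>.\<close>
  have lower: "169 / 100 * M\<^sup>2 \<le> (x i + x j)\<^sup>2" if "(i, j) \<in> arcs ?K - arcs G" for i j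
  proof -
    have ij: "?K i j" "\<not> G i j" using that by (auto simp: arcs_def)
    have "i < n" "j < n" "i \<noteq> v" "j \<noteq> v"
      using ij S simple_graphD(4)[OF G] by (auto simp: pendant_clique_def)
    then have "13 / 20 * M \<le> x i" "13 / 20 * M \<le> x j" using xw by blast+
    then have "13 / 10 * M \<le> x i + x j" by linarith
    then have "(13 / 10 * M)\<^sup>2 \<le> (x i + x j)\<^sup>2" using M by (intro power_mono) auto
    then show ?thesis by (simp add: power2_eq_square)
  qed
  \<comment> \<open>Arcs lost meet \<open>v\<close>, so their end sum is at most
    \<open>(1 + 3/25) * M\<close>. The factor 9/10 records a gap that makes the comparison
    strict.\<close>
  have upper: "(x i + x j)\<^sup>2 \<le> 169 / 100 * M\<^sup>2 * (9 / 10)" if "(i, j) \<in> arcs G - arcs ?K" for i j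
  proof -
    have ij: "\<not> ?K i j" "G i j" using that by (auto simp: arcs_def)
    have "i < n" "j < n" "i = v \<or> j = v"
      using ij simple_graphD[OF G] by (auto simp: pendant_clique_def)
    then have "x i + x j \<le> 28 / 25 * M" using xM[of i] xM[of j] xv by (elim disjE) auto
    then have "(x i + x j)\<^sup>2 \<le> (28 / 25 * M)\<^sup>2" using x(1) by (intro power_mono) auto
    also have "\<dots> = 784 / 625 * M\<^sup>2" by (simp add: power2_eq_square)
    also have "\<dots> \<le> 169 / 100 * M\<^sup>2 * (9 / 10)" by simp
    finally show ?thesis .
  qed
  define a where "a = real (card (arcs G - arcs ?K))"
  define b where "b = real (card (arcs ?K - arcs G))"
  have finG: "finite (arcs G)" and finK: "finite (arcs ?K)"
    using finite_arcs[OF G] finite_arcs[OF K] by auto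
  have ab: "a \<le> b" "0 < b"
    using card ne finK by (auto simp: a_def b_def card_gt_0_iff)
  have "qform G x = (\<Sum>(i, j)\<in>arcs G - arcs ?K. (x i + x j)\<^sup>2) + (\<Sum>(i, j)\<in>arcs G \<inter> arcs ?K. (x i + x j)\<^sup>2)"
    unfolding qform_def using finG by (subst sum.Int_Diff[of _ _ "arcs ?K"]) auto
  moreover have "qform ?K x = (\<Sum>(i, j)\<in>arcs ?K - arcs G. (x i + x j)\<^sup>2) + (\<Sum>(i, j)\<in>arcs G \<inter> arcs ?K. (x i + x j)\<^sup>2)"
    unfolding qform_def using finK by (subst sum.Int_Diff[of _ _ "arcs G"]) (auto simp: Int_commute)
  moreover have "(\<Sum>(i, j)\<in>arcs G - arcs ?K. (x i + x j)\<^sup>2) \<le> a * (169 / 100 * M\<^sup>2 * (9 / 10))"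
    unfolding a_def by (intro sum_bounded_above) (use upper in auto)
  moreover have "b * (169 / 100 * M\<^sup>2) \<le> (\<Sum>(i, j)\<in>arcs ?K - arcs G. (x i + x j)\<^sup>2)"
    unfolding b_def by (intro sum_bounded_below) (use lower in auto)
  moreover have "a * (169 / 100 * M\<^sup>2 * (9 / 10)) < b * (169 / 100 * M\<^sup>2)"
  proof -
    have "a * (169 / 100 * M\<^sup>2 * (9 / 10)) \<le> b * (169 / 100 * M\<^sup>2 * (9 / 10))"
      using ab by (intro mult_right_mono) auto
    also have "\<dots> < b * (169 / 100 * M\<^sup>2)" using ab M by simp
    finally show ?thesis .
  qed
  ultimately have "qform G x < qform ?K x" by linarith
  moreover have "qform G x = 2 * q_index n G"
    using qform_eigenvector[OF G x(3)] x(2) by simp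
  moreover have "qform ?K x \<le> 2 * q_index n ?K"
    using qform_le_q_index[OF K, of x] x(2) n by simp
  ultimately show ?thesis by linarith
qed

section \<open>Packing two sparse graphs\<close>

text \<open>\<open>R\<close> plays the complement of \<open>G\<close>: few edges in total, but
  possibly huge degrees. A map \<open>\<sigma>\<close> places vertices of \<open>R\<close> on
  vertices of \<open>F\<close>, and a conflict is an edge of \<open>R\<close> landing on an edge of
  \<open>F\<close>.\<close>

locale sparse_pair =
  fixes n :: nat and R F :: "nat \<Rightarrow> nat \<Rightarrow> bool" and D :: nat
  assumes R: "simple_graph n R" and F: "simple_graph n F"
    and degree_F: "\<And>i. Defs.degree F i \<le> D"
    and sum_degree_R: "(\<Sum>i<n. Defs.degree R i) \<le> 2 * n"
begin

text \<open>Bounds the number of vertices that cannot be moved to position \<open>v\<close> because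
  an \<open>R\<close>-neighbour in \<open>A\<close> already sits on an \<open>F\<close>-neighbour of
  \<open>v\<close>.\<close>

definition load :: "(nat \<Rightarrow> nat) \<Rightarrow> nat set \<Rightarrow> nat \<Rightarrow> nat" where
  "load \<sigma> A v = (\<Sum>a\<in>{a \<in> A. F v (\<sigma> a)}. Defs.degree R a)"

definition conflicts :: "(nat \<Rightarrow> nat) \<Rightarrow> (nat \<times> nat) set" where
  "conflicts \<sigma> = {(a, b). R a b \<and> F (\<sigma> a) (\<sigma> b)}"

lemma finite_conflicts: "finite (conflicts \<sigma>)"
  by (rule finite_subset[OF _ finite_arcs[OF R]]) (auto simp: conflicts_def arcs_def)

lemma F_sym: "F a b \<longleftrightarrow> F b a" and R_sym: "R a b \<longleftrightarrow> R b a"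
  using simple_graphD(4)[OF F] simple_graphD(4)[OF R] by blast+

lemma load_cong:
  assumes "\<And>a. a \<in> A \<Longrightarrow> \<sigma> a = \<tau> a"
  shows "load \<sigma> A v = load \<tau> A v"
  unfolding load_def using assms by (intro sum.cong) auto

lemma card_preimage_nbhd:
  assumes "inj_on \<sigma> A"
  shows "card {a \<in> A. F v (\<sigma> a)} \<le> D"
proof -
  have "card {a \<in> A. F v (\<sigma> a)} \<le> card (nbhd F v)"
    using assms by (intro card_inj_on_le[of \<sigma>] finite_nbhd[OF F]) (auto simp: inj_on_def)
  then show ?thesis using degree_F[of v] by (simp add: Defs.degree_def)
qed

text \<open>Double counting: each \<open>a\<close> contributes its degree in \<open>R\<close> to at
  most \<open>D\<close> positions.\<close>

lemma sum_load:
  assumes "A \<subseteq> {..<n}"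
  shows "(\<Sum>v<n. load \<sigma> A v) \<le> 2 * n * D"
proof -
  have fin: "finite A" using assms by (rule finite_subset) auto
  have "(\<Sum>v<n. load \<sigma> A v) = (\<Sum>v<n. \<Sum>a\<in>A. if F v (\<sigma> a) then Defs.degree R a else 0)"
    unfolding load_def by (simp add: sum.inter_filter[OF fin])
  also have "\<dots> = (\<Sum>a\<in>A. \<Sum>v<n. if F v (\<sigma> a) then Defs.degree R a else 0)"
    by (rule sum.swap)
  also have "\<dots> \<le> (\<Sum>a\<in>A. Defs.degree R a * D)"
  proof (rule sum_mono)
    fix a assume "a \<in> A"
    have "{v \<in> {..<n}. F v (\<sigma> a)} = nbhd F (\<sigma> a)"
      using simple_graphD[OF F] by blast
    then have "(\<Sum>v<n. if F v (\<sigma> a) then Defs.degree R a else 0) = Defs.degree F (\<sigma> a) * Defs.degree R a"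
      by (simp add: sum.If_cases Int_def Defs.degree_def)
    then show "(\<Sum>v<n. if F v (\<sigma> a) then Defs.degree R a else 0) \<le> Defs.degree R a * D"
      using degree_F[of "\<sigma> a"] by simp
  qed
  also have "\<dots> = (\<Sum>a\<in>A. Defs.degree R a) * D"
    by (simp add: sum_distrib_right)
  also have "(\<Sum>a\<in>A. Defs.degree R a) \<le> (\<Sum>a<n. Defs.degree R a)"
    using assms by (intro sum_mono2) auto
  also have "\<dots> \<le> 2 * n" by (rule sum_degree_R)
  finally show ?thesis by simp
qed

text \<open>Since the total load is at most \<open>2nD\<close>, only \<open>20D\<close> vertices carry a load above \<open>n/10\<close>.
  Keeping the new vertex away from their neighbourhoods means that no load can jump twice.\<close>
lemma greedy_placement:
  assumes P: "P \<subseteq> {..<n}" "inj_on \<sigma>\<^sub>0 P" "\<sigma>\<^sub>0 ` P \<subseteq> {..<n}"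
    and free: "\<And>a b. a \<in> P \<Longrightarrow> b \<in> P \<Longrightarrow> R a b \<Longrightarrow> \<not> F (\<sigma>\<^sub>0 a) (\<sigma>\<^sub>0 b)"
    and B: "finite B" "B \<subseteq> {..<n} - P" "\<And>b. b \<in> B \<Longrightarrow> Defs.degree R b \<le> M"
    and small: "(card P + card B) * (D + 1) + 20 * D * D < n"
  shows "\<exists>\<sigma>. (\<forall>a\<in>P. \<sigma> a = \<sigma>\<^sub>0 a) \<and> inj_on \<sigma> (P \<union> B) \<and> \<sigma> ` (P \<union> B) \<subseteq> {..<n} \<and>
    (\<forall>a\<in>P \<union> B. \<forall>b\<in>P \<union> B. R a b \<longrightarrow> \<not> F (\<sigma> a) (\<sigma> b)) \<and>
    (\<forall>v. 10 * load \<sigma> B v \<le> n + 10 * M)"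
  using B small
proof (induction B rule: finite_induct)
  case empty
  then show ?case using P free by (intro exI[of _ \<sigma>\<^sub>0]) (auto simp: load_def)
next
  case (insert b B)
  have finP: "finite P" using P(1) by (rule finite_subset) auto
  have "(card P + card B) * (D + 1) \<le> (card P + card (insert b B)) * (D + 1)"
    using insert.hyps by (intro mult_right_mono) auto
  then have small': "(card P + card B) * (D + 1) + 20 * D * D < n"
    using insert.prems(3) by linarith
  then obtain \<sigma> where \<sigma>: "\<forall>a\<in>P. \<sigma> a = \<sigma>\<^sub>0 a" "inj_on \<sigma> (P \<union> B)" "\<sigma> ` (P \<union> B) \<subseteq> {..<n}"
    "\<forall>a\<in>P \<union> B. \<forall>b\<in>P \<union> B. R a b \<longrightarrow> \<not> F (\<sigma> a) (\<sigma> b)"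
    "\<forall>v. 10 * load \<sigma> B v \<le> n + 10 * M"
    using insert.IH insert.prems by (auto simp del: mult_Suc_right)
  define heavy where "heavy = {v \<in> {..<n}. n < 10 * load \<sigma> B v}"
  have "card heavy * n = (\<Sum>v\<in>heavy. n)" by simp
  also have "\<dots> \<le> (\<Sum>v\<in>heavy. 10 * load \<sigma> B v)"
    by (intro sum_mono) (auto simp: heavy_def)
  also have "\<dots> \<le> (\<Sum>v<n. 10 * load \<sigma> B v)"
    by (intro sum_mono2) (auto simp: heavy_def)
  also have "\<dots> = 10 * (\<Sum>v<n. load \<sigma> B v)" by (simp add: sum_distrib_left)
  also have "\<dots> \<le> 10 * (2 * n * D)"
    using insert.prems(1) by (intro mult_left_mono sum_load) auto
  finally have "card heavy * n \<le> (20 * D) * n" by (simp add: algebra_simps)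
  then have heavy: "card heavy \<le> 20 * D" using small' by simp
  \<comment> \<open>Three exclusions: occupied positions, positions adjacent in \<open>F\<close> to
    an occupied one, and positions that would raise the load of a heavy vertex.\<close>
  define bad where
    "bad = \<sigma> ` (P \<union> B) \<union> (\<Union>p\<in>P \<union> B. nbhd F (\<sigma> p)) \<union> (\<Union>v\<in>heavy. nbhd F v)"
  have PB: "finite (P \<union> B)" "card (P \<union> B) \<le> card P + card B"
    using finP insert.hyps by (auto intro: card_Un_le)
  have nb: "card (nbhd F v) \<le> D" for v
    using degree_F[of v] by (simp add: Defs.degree_def)
  have c1: "card (\<sigma> ` (P \<union> B)) \<le> card (P \<union> B)"
    using PB by (intro card_image_le)
  have c2: "card (\<Union>p\<in>P \<union> B. nbhd F (\<sigma> p)) \<le> card (P \<union> B) * D"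
    using card_UN_le[OF PB(1), of "\<lambda>p. nbhd F (\<sigma> p)"] sum_bounded_above[of "P \<union> B" "\<lambda>p. card (nbhd F (\<sigma> p))" D] nb
    by fastforce
  have finh: "finite heavy" by (simp add: heavy_def)
  have c3: "card (\<Union>v\<in>heavy. nbhd F v) \<le> card heavy * D"
    using card_UN_le[OF finh, of "nbhd F"] sum_bounded_above[of heavy "\<lambda>p. card (nbhd F p)" D] nb
    by fastforce
  have c4: "card heavy * D \<le> 20 * D * D" using heavy by (rule mult_right_mono) simp
  have c5: "card (P \<union> B) * (D + 1) \<le> (card P + card B) * (D + 1)"
    using PB(2) by (rule mult_right_mono) simp
  have c6: "card (P \<union> B) * (D + 1) = card (P \<union> B) * D + card (P \<union> B)" by simp
  have "card bad \<le> card (\<sigma> ` (P \<union> B)) + card (\<Union>p\<in>P \<union> B. nbhd F (\<sigma> p)) + card (\<Union>v\<in>heavy. nbhd F v)"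
    unfolding bad_def by (meson add_le_mono1 card_Un_le order.trans)
  also have "\<dots> \<le> (card P + card B) * (D + 1) + 20 * D * D"
    using c1 c2 c3 c4 c5 c6 by linarith
  also have "\<dots> < n" by (rule small')
  finally have "card bad < card {..<n}" by simp
  then have "\<not> {..<n} \<subseteq> bad"
    using card_mono[of bad "{..<n}"] PB finh finite_nbhd[OF F]
    unfolding bad_def by (meson finite_UN_I finite_UnI finite_imageI not_less)
  then obtain u where u: "u < n" "u \<notin> bad" by auto
  define \<tau> where "\<tau> = \<sigma>(b := u)"
  have bn: "b \<notin> P \<union> B" using insert.prems(1) insert.hyps(2) by auto
  have same: "\<tau> a = \<sigma> a" if "a \<in> P \<union> B" for a
    using bn that by (auto simp: \<tau>_def)
  have tb: "\<tau> b = u" by (simp add: \<tau>_def)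
  have "u \<notin> \<sigma> ` (P \<union> B)" using u by (simp add: bad_def)
  then have inj: "inj_on \<tau> (insert b (P \<union> B))"
    unfolding \<tau>_def using \<sigma>(2) bn by (auto simp: inj_on_insert inj_on_fun_updI inj_on_def)
  have uF: "\<not> F (\<sigma> p) u \<and> \<not> F u (\<sigma> p)" if "p \<in> P \<union> B" for p
    using u that F_sym by (auto simp: bad_def)
  have "\<not> R b b" using simple_graphD(3)[OF R] by blast
  then have noconf: "\<not> F (\<tau> c) (\<tau> e)"
    if "c \<in> insert b (P \<union> B)" "e \<in> insert b (P \<union> B)" "R c e" for c e
    using that \<sigma>(4) uF same tb by (metis insert_iff)
  \<comment> \<open>Only \<open>F\<close>-neighbours of \<open>u\<close> gain load. They are not
    heavy, so one increment of at most \<open>M\<close> stays within the bound.\<close>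
  have ld: "10 * load \<tau> (insert b B) v \<le> n + 10 * M" for v
  proof (cases "F v u")
    case True
    have "v < n" using simple_graphD(1)[OF F True] .
    moreover have "v \<notin> heavy" using u True by (auto simp: bad_def)
    ultimately have l: "10 * load \<sigma> B v \<le> n" by (simp add: heavy_def)
    have "{a \<in> insert b B. F v (\<tau> a)} = insert b {a \<in> B. F v (\<sigma> a)}"
      using True tb same by auto
    then have "load \<tau> (insert b B) v = Defs.degree R b + load \<sigma> B v"
      unfolding load_def using insert.hyps by simp
    then show ?thesis using l insert.prems(2)[of b] by simp
  next
    case False
    have "{a \<in> insert b B. F v (\<tau> a)} = {a \<in> B. F v (\<sigma> a)}"
      using False tb same by auto
    then show ?thesis using \<sigma>(5) by (simp add: load_def)
  qed
  show ?case
  proof (intro exI[of _ \<tau>] conjI)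
    show "\<forall>a\<in>P. \<tau> a = \<sigma>\<^sub>0 a" using same \<sigma>(1) by simp
    show "inj_on \<tau> (P \<union> insert b B)" using inj by simp
    show "\<tau> ` (P \<union> insert b B) \<subseteq> {..<n}" using same tb u(1) \<sigma>(3) by auto
    show "\<forall>a\<in>P \<union> insert b B. \<forall>c\<in>P \<union> insert b B. R a c \<longrightarrow> \<not> F (\<tau> a) (\<tau> c)"
      using noconf by simp
    show "\<forall>v. 10 * load \<tau> (insert b B) v \<le> n + 10 * M" using ld by blast
  qed
qed

text \<open>Exchanging the images of \<open>a\<close> and a suitable \<open>a'\<close> affects only
  pairs meeting one of them. If neither has a conflict afterwards, the old conflict disappears and
  no new one arises.\<close>

lemma swap_conflict:
  assumes \<sigma>: "bij_betw \<sigma> {..<n} {..<n}" and ab: "R a b" "F (\<sigma> a) (\<sigma> b)"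
    and aP: "a \<notin> P" and P: "P \<subseteq> {..<n}" and T: "Defs.degree R a \<le> T"
    and room: "load \<sigma> {..<n} (\<sigma> a) + T * D + D + card P + 1 < n"
  shows "\<exists>\<tau>. bij_betw \<tau> {..<n} {..<n} \<and> (\<forall>p\<in>P. \<tau> p = \<sigma> p) \<and> conflicts \<tau> \<subset> conflicts \<sigma>"
proof -
  have an: "a < n" using simple_graphD(1)[OF R ab(1)] .
  have inj: "inj_on \<sigma> {..<n}" using \<sigma> by (rule bij_betw_imp_inj_on)
  define N where "N v = {c \<in> {..<n}. F v (\<sigma> c)}" for v
  have N: "card (N v) \<le> D" "finite (N v)" for v
    using card_preimage_nbhd[OF inj, of v] by (auto simp: N_def)
  \<comment> \<open>Besides \<open>P\<close> and \<open>a\<close>, this excludes an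
    \<open>F\<close>-edge between the two images, conflicts of \<open>a'\<close> at the old place of
    \<open>a\<close> (counted by \<open>load\<close>), and conflicts of \<open>a\<close> at the old
    place of \<open>a'\<close> (at most \<open>T * D\<close>).\<close>
  define bad where
    "bad = P \<union> {a} \<union> N (\<sigma> a) \<union> (\<Union>c\<in>N (\<sigma> a). nbhd R c) \<union> (\<Union>c\<in>nbhd R a. N (\<sigma> c))"
  have finP: "finite P" using P by (rule finite_subset) auto
  have c1: "card (\<Union>c\<in>N (\<sigma> a). nbhd R c) \<le> load \<sigma> {..<n} (\<sigma> a)"
    using card_UN_le[OF N(2), of "nbhd R" "\<sigma> a"] by (simp add: load_def N_def Defs.degree_def)
  have c2: "card (\<Union>c\<in>nbhd R a. N (\<sigma> c)) \<le> T * D"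
  proof -
    have "card (\<Union>c\<in>nbhd R a. N (\<sigma> c)) \<le> (\<Sum>c\<in>nbhd R a. card (N (\<sigma> c)))"
      by (intro card_UN_le finite_nbhd[OF R])
    also have "\<dots> \<le> card (nbhd R a) * D"
      using sum_bounded_above[of "nbhd R a" "\<lambda>c. card (N (\<sigma> c))" D] N(1) by simp
    also have "\<dots> \<le> T * D" using T by (simp add: Defs.degree_def)
    finally show ?thesis .
  qed
  have "card bad \<le> card P + 1 + D + load \<sigma> {..<n} (\<sigma> a) + T * D"
    unfolding bad_def
    by (intro order.trans[OF card_Un_le] add_mono c1 c2 N(1)) auto
  also have "\<dots> < card {..<n}" using room by simp
  finally have "\<not> {..<n} \<subseteq> bad"
    using card_mono[of bad "{..<n}"] finP finite_nbhd[OF R] N(2)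
    unfolding bad_def by (meson finite.emptyI finite_insert finite_UN_I finite_UnI not_less)
  then obtain a' where a': "a' < n" "a' \<notin> bad" by auto
  have neq: "a' \<noteq> a" and aP': "a' \<notin> P" and f1: "\<not> F (\<sigma> a) (\<sigma> a')"
    using a' by (auto simp: bad_def N_def)
  have f2: "\<not> R c a'" if "F (\<sigma> a) (\<sigma> c)" "c < n" for c
    using a' that by (auto simp: bad_def N_def)
  have f3: "\<not> F (\<sigma> c) (\<sigma> a')" if "R a c" for c
    using a' that by (auto simp: bad_def N_def)
  define \<tau> where "\<tau> = \<sigma> \<circ> Transposition.transpose a a'"
  have "bij_betw (Transposition.transpose a a') {..<n} {..<n}"
    using an a'(1) by (intro bij_betw_byWitness[where f' = "Transposition.transpose a a'"])
      (auto simp: Transposition.transpose_def)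
  then have bij: "bij_betw \<tau> {..<n} {..<n}"
    unfolding \<tau>_def using \<sigma> by (rule bij_betw_trans)
  have ta: "\<tau> a = \<sigma> a'" and ta': "\<tau> a' = \<sigma> a"
    and tc: "\<And>c. c \<noteq> a \<Longrightarrow> c \<noteq> a' \<Longrightarrow> \<tau> c = \<sigma> c"
    by (auto simp: \<tau>_def Transposition.transpose_def)
  have left: "c \<noteq> a \<and> c \<noteq> a'" if "R c e" "F (\<tau> c) (\<tau> e)" for c e
  proof -
    have e: "e < n" "c \<noteq> e" using simple_graphD[OF R \<open>R c e\<close>] by auto
    have "c \<noteq> a"
    proof
      assume [simp]: "c = a"
      show False
      proof (cases "e = a'")
        case True
        then show False using that f1 F_sym ta ta' by simp
      next
        case False
        then show False using that f3[of e] F_sym ta tc[of e] e by simp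
      qed
    qed
    moreover have "c \<noteq> a'"
    proof
      assume [simp]: "c = a'"
      show False
      proof (cases "e = a")
        case True
        then show False using that f1 F_sym ta ta' by simp
      next
        case False
        then show False using that f2[of e] R_sym ta' tc[of e] e by simp
      qed
    qed
    ultimately show ?thesis by blast
  qed
  have "conflicts \<tau> \<subseteq> conflicts \<sigma>"
  proof
    fix p assume "p \<in> conflicts \<tau>"
    then obtain c e where p: "p = (c, e)" "R c e" "F (\<tau> c) (\<tau> e)"
      by (auto simp: conflicts_def)
    then have "c \<noteq> a \<and> c \<noteq> a'" "e \<noteq> a \<and> e \<noteq> a'"
      using left[of c e] left[of e c] R_sym F_sym by blast+
    then show "p \<in> conflicts \<sigma>" using p tc by (simp add: conflicts_def)
  qed
  moreover have "(a, b) \<in> conflicts \<sigma>" using ab by (simp add: conflicts_def)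
  moreover have "(a, b) \<notin> conflicts \<tau>" using left[of a b] by (auto simp: conflicts_def)
  ultimately have "conflicts \<tau> \<subset> conflicts \<sigma>" by blast
  moreover have "\<forall>p\<in>P. \<tau> p = \<sigma> p" using tc aP aP' by metis
  ultimately show ?thesis using bij by blast
qed

text \<open>Every conflict has an end outside \<open>P\<close>, and swapping that end lowers the
  number of conflicts. \<open>P\<close> never moves, so its hypotheses persist. One
  \<open>T * D\<close> in \<open>room\<close> pays for the load from outside \<open>P\<close>, the
  other for the swap.\<close>

lemma resolve_conflicts:
  assumes \<sigma>: "bij_betw \<sigma> {..<n} {..<n}" and P: "P \<subseteq> {..<n}"
    and free: "\<And>a b. a \<in> P \<Longrightarrow> b \<in> P \<Longrightarrow> R a b \<Longrightarrow> \<not> F (\<sigma> a) (\<sigma> b)"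
    and T: "\<And>a. a < n \<Longrightarrow> a \<notin> P \<Longrightarrow> Defs.degree R a \<le> T"
    and L: "\<And>v. v \<notin> \<sigma> ` P \<Longrightarrow> load \<sigma> P v \<le> L"
    and room: "L + 2 * (T * D) + D + card P + 1 < n"
  shows "\<exists>\<tau>. bij_betw \<tau> {..<n} {..<n} \<and> conflicts \<tau> = {}"
  using \<sigma> free L
proof (induction "card (conflicts \<sigma>)" arbitrary: \<sigma> rule: less_induct)
  case less
  show ?case
  proof (cases "conflicts \<sigma> = {}")
    case True
    then show ?thesis using less.prems(1) by blast
  next
    case False
    then obtain a b where ab: "R a b" "F (\<sigma> a) (\<sigma> b)" "a \<notin> P"
      using less.prems(2) R_sym F_sym unfolding conflicts_def by blast
    have an: "a < n" using simple_graphD(1)[OF R ab(1)] .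
    have inj: "inj_on \<sigma> {..<n}" using less.prems(1) by (rule bij_betw_imp_inj_on)
    have "\<sigma> a \<notin> \<sigma> ` P"
      using inj_on_image_mem_iff[OF inj _ P] an ab(3) by simp
    then have l1: "load \<sigma> P (\<sigma> a) \<le> L" by (rule less.prems(3))
    have l2: "load \<sigma> ({..<n} - P) (\<sigma> a) \<le> T * D"
    proof -
      let ?A = "{c \<in> {..<n} - P. F (\<sigma> a) (\<sigma> c)}"
      have "load \<sigma> ({..<n} - P) (\<sigma> a) \<le> card ?A * T"
        unfolding load_def using sum_bounded_above[of ?A "Defs.degree R" T] T by simp
      also have "\<dots> \<le> D * T"
        using card_preimage_nbhd[of \<sigma> "{..<n} - P" "\<sigma> a"] inj
        by (intro mult_right_mono) (auto intro: inj_on_subset)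
      finally show ?thesis by (simp add: mult.commute)
    qed
    have "load \<sigma> {..<n} (\<sigma> a) = load \<sigma> P (\<sigma> a) + load \<sigma> ({..<n} - P) (\<sigma> a)"
    proof -
      have "{c \<in> {..<n}. F (\<sigma> a) (\<sigma> c)} = {c \<in> P. F (\<sigma> a) (\<sigma> c)} \<union> {c \<in> {..<n} - P. F (\<sigma> a) (\<sigma> c)}"
        using P by auto
      moreover have "finite P" using P by (rule finite_subset) auto
      ultimately show ?thesis
        unfolding load_def by (simp only:) (intro sum.union_disjoint; auto)
    qed
    then have "load \<sigma> {..<n} (\<sigma> a) + T * D + D + card P + 1 < n"
      using l1 l2 room by linarith
    then obtain \<tau> where \<tau>: "bij_betw \<tau> {..<n} {..<n}" "\<forall>p\<in>P. \<tau> p = \<sigma> p" "conflicts \<tau> \<subset> conflicts \<sigma>"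
      using swap_conflict[OF less.prems(1) ab P T[OF an ab(3)]] by blast
    have "card (conflicts \<tau>) < card (conflicts \<sigma>)"
      using \<tau>(3) finite_conflicts by (intro psubset_card_mono)
    moreover have "\<not> F (\<tau> c) (\<tau> e)" if "c \<in> P" "e \<in> P" "R c e" for c e
      using less.prems(2) \<tau>(2) that by simp
    moreover have "load \<tau> P v \<le> L" if "v \<notin> \<tau> ` P" for v
    proof -
      have "\<tau> ` P = \<sigma> ` P" using \<tau>(2) by (intro image_cong) auto
      then show ?thesis using less.prems(3)[of v] that load_cong[of P \<tau> \<sigma> v] \<tau>(2) by simp
    qed
    ultimately show ?thesis using less.hyps[OF _ \<tau>(1)] by blast
  qed
qed

lemma extend_to_bij:
  assumes "P \<subseteq> {..<n}" "inj_on \<sigma> P" "\<sigma> ` P \<subseteq> {..<n}"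
  obtains \<tau> where "bij_betw \<tau> {..<n} {..<n}" "\<And>a. a \<in> P \<Longrightarrow> \<tau> a = \<sigma> a"
proof -
  have fin: "finite P" using assms(1) by (rule finite_subset) auto
  have "card ({..<n} - P) = card ({..<n} - \<sigma> ` P)"
    using assms fin by (simp add: card_Diff_subset card_image)
  then obtain h where h: "bij_betw h ({..<n} - P) ({..<n} - \<sigma> ` P)"
    using finite_same_card_bij[of "{..<n} - P" "{..<n} - \<sigma> ` P"] by auto
  define \<tau> where "\<tau> a = (if a \<in> P then \<sigma> a else h a)" for a
  have "bij_betw \<tau> P (\<sigma> ` P)"
    using assms(2) by (auto simp: bij_betw_def \<tau>_def inj_on_def image_iff)
  moreover have "bij_betw \<tau> ({..<n} - P) ({..<n} - \<sigma> ` P)"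
    using h by (rule bij_betw_cong[THEN iffD1, rotated]) (auto simp: \<tau>_def)
  ultimately have "bij_betw \<tau> (P \<union> ({..<n} - P)) (\<sigma> ` P \<union> ({..<n} - \<sigma> ` P))"
    by (rule bij_betw_combine) auto
  moreover have "P \<union> ({..<n} - P) = {..<n}" "\<sigma> ` P \<union> ({..<n} - \<sigma> ` P) = {..<n}"
    using assms by auto
  ultimately show ?thesis using that[of \<tau>] by (simp add: \<tau>_def)
qed

text \<open>The vertices of degree above \<open>\<surd>n\<close> in \<open>R\<close> are placed greedily; all other vertices can be
  swapped freely, in the style of Sauer and Spencer, until no conflict is left.\<close>
lemma packing_extends:
  assumes n: "2500 \<le> n" and D: "1600 * D\<^sup>2 \<le> n"
    and P: "P \<subseteq> {..<n}" "inj_on \<sigma>\<^sub>0 P" "\<sigma>\<^sub>0 ` P \<subseteq> {..<n}" "card P \<le> D + 1"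
    and free: "\<And>a b. a \<in> P \<Longrightarrow> b \<in> P \<Longrightarrow> R a b \<Longrightarrow> \<not> F (\<sigma>\<^sub>0 a) (\<sigma>\<^sub>0 b)"
    and L0: "\<And>v. v \<notin> \<sigma>\<^sub>0 ` P \<Longrightarrow> load \<sigma>\<^sub>0 P v \<le> L0"
    and M: "\<And>a. a < n \<Longrightarrow> a \<notin> P \<Longrightarrow> Defs.degree R a \<le> M"
    and L0M: "5 * (L0 + M) \<le> 4 * n"
  shows "\<exists>\<sigma>. bij_betw \<sigma> {..<n} {..<n} \<and> (\<forall>a b. R a b \<longrightarrow> \<not> F (\<sigma> a) (\<sigma> b))"
proof -
  define T where "T = floor_sqrt n"
  have T: "T\<^sup>2 \<le> n" "n < (T + 1)\<^sup>2"
    by (simp_all add: T_def Suc_floor_sqrt_power2_gt)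
  have DT: "40 * D \<le> T"
  proof -
    have "(40 * D)\<^sup>2 \<le> n" using D by (simp add: power_mult_distrib)
    then show ?thesis unfolding T_def by (simp add: le_floor_sqrt_iff)
  qed
  \<comment> \<open>This is where 2500 enters, as the square of 50.\<close>
  have T50: "50 \<le> T"
    unfolding T_def le_floor_sqrt_iff using n by simp
  define B where "B = {a \<in> {..<n} - P. T < Defs.degree R a}"
  have B: "finite B" "B \<subseteq> {..<n} - P" by (auto simp: B_def)
  \<comment> \<open>The degree sum is at most \<open>2 * n\<close>, so there are fewer than
    \<open>2 * (T + 1)\<close> vertices of degree above \<open>T\<close>.\<close>
  have "card B * (T + 1) \<le> (\<Sum>a\<in>B. Defs.degree R a)"
    using sum_bounded_below[of B "T + 1" "Defs.degree R"] by (simp add: B_def)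
  also have "\<dots> \<le> (\<Sum>a<n. Defs.degree R a)"
    using B by (intro sum_mono2) auto
  also have "\<dots> < 2 * (T + 1) * (T + 1)"
    using sum_degree_R T(2) by (simp add: power2_eq_square)
  finally have "card B < 2 * (T + 1)" by (rule mult_right_less_imp_less) simp
  then have PB: "card P + card B \<le> D + 2 * T + 2" using P(4) by simp
  \<comment> \<open>From here every term is measured against \<open>T\<^sup>2 \<le> n\<close>, with
    \<open>D\<close> at most \<open>T / 40\<close> and \<open>T\<close> at least 50.\<close>
  have reals: "real D \<le> real T / 40" "50 \<le> real T" "(real T)\<^sup>2 \<le> real n"
    using DT T50 T(1) by (auto simp flip: of_nat_power)
  have T2: "50 * real T \<le> (real T)\<^sup>2"
    using reals(2) by (simp add: power2_eq_square)
  have DD: "real D * real D \<le> (real T)\<^sup>2 / 1600"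
    using mult_mono[OF reals(1) reals(1)] by (simp add: power2_eq_square)
  have TD: "real T * real D \<le> (real T)\<^sup>2 / 40"
    using mult_left_mono[OF reals(1), of "real T"] by (simp add: power2_eq_square)
  have "(card P + card B) * (D + 1) + 20 * D * D \<le> (D + 2 * T + 2) * (D + 1) + 20 * D * D"
    by (rule add_right_mono, rule mult_right_mono) (use PB in auto)
  also have "\<dots> < n"
  proof -
    have "real ((D + 2 * T + 2) * (D + 1) + 20 * D * D) =
        21 * (real D * real D) + 2 * (real T * real D) + 3 * real D + 2 * real T + 2"
      by (simp add: algebra_simps)
    also have "\<dots> < real n" using DD TD reals T2 by linarith
    finally show ?thesis by (simp only: of_nat_less_iff)
  qed
  finally have small: "(card P + card B) * (D + 1) + 20 * D * D < n" .
  have BM: "\<And>b. b \<in> B \<Longrightarrow> Defs.degree R b \<le> M"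
    using M by (auto simp: B_def)
  obtain \<sigma> where \<sigma>: "\<forall>a\<in>P. \<sigma> a = \<sigma>\<^sub>0 a" "inj_on \<sigma> (P \<union> B)" "\<sigma> ` (P \<union> B) \<subseteq> {..<n}"
    "\<forall>a\<in>P \<union> B. \<forall>b\<in>P \<union> B. R a b \<longrightarrow> \<not> F (\<sigma> a) (\<sigma> b)"
    "\<forall>v. 10 * load \<sigma> B v \<le> n + 10 * M"
    using greedy_placement[OF P(1-3) free B BM small] by blast
  have PBn: "P \<union> B \<subseteq> {..<n}" using P(1) B(2) by auto
  obtain \<tau> where \<tau>: "bij_betw \<tau> {..<n} {..<n}" "\<And>a. a \<in> P \<union> B \<Longrightarrow> \<tau> a = \<sigma> a"
    using extend_to_bij[OF PBn \<sigma>(2,3)] by blast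
  \<comment> \<open>At most \<open>4n/5\<close> comes from \<open>L0 + M\<close> and
    \<open>n/10\<close> from the greedy phase; the last tenth of \<open>n\<close> pays for the
    swaps.\<close>
  define L where "L = 9 * n div 10"
  have ld: "load \<tau> (P \<union> B) v \<le> L" if "v \<notin> \<tau> ` (P \<union> B)" for v
  proof -
    have "\<tau> ` P = \<sigma>\<^sub>0 ` P" using \<tau>(2) \<sigma>(1) by (intro image_cong) auto
    then have "v \<notin> \<sigma>\<^sub>0 ` P" using that by blast
    then have "load \<sigma>\<^sub>0 P v \<le> L0" by (rule L0)
    moreover have "load \<tau> (P \<union> B) v = load \<sigma>\<^sub>0 P v + load \<sigma> B v"
    proof -
      have "{a \<in> P \<union> B. F v (\<tau> a)} = {a \<in> P. F v (\<sigma>\<^sub>0 a)} \<union> {a \<in> B. F v (\<sigma> a)}"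
        using \<tau>(2) \<sigma>(1) by auto
      moreover have "finite P" using P(1) by (rule finite_subset) auto
      ultimately show ?thesis
        unfolding load_def using B by (simp only:) (intro sum.union_disjoint; auto)
    qed
    ultimately have "10 * load \<tau> (P \<union> B) v \<le> 9 * n"
      using spec[OF \<sigma>(5), of v] L0M by (simp add: algebra_simps)
    then show ?thesis unfolding L_def by linarith
  qed
  have "card (P \<union> B) \<le> D + 2 * T + 2" using PB card_Un_le[of P B] by linarith
  then have "real (card (P \<union> B)) \<le> real (D + 2 * T + 2)" by (simp only: of_nat_le_iff)
  moreover have "real (10 * L) \<le> real (9 * n)" unfolding of_nat_le_iff L_def by simp
  ultimately have "real (L + 2 * (T * D) + D + card (P \<union> B) + 1) \<le>
      9 / 10 * real n + 2 * (real T * real D) + 2 * real D + 2 * real T + 3"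
    by simp
  also have "\<dots> < real n" using TD reals T2 by linarith
  finally have room: "L + 2 * (T * D) + D + card (P \<union> B) + 1 < n" by (simp only: of_nat_less_iff)
  have "\<exists>\<tau>. bij_betw \<tau> {..<n} {..<n} \<and> conflicts \<tau> = {}"
  proof (rule resolve_conflicts[OF \<tau>(1) PBn _ _ ld room])
    show "\<not> F (\<tau> a) (\<tau> b)" if "a \<in> P \<union> B" "b \<in> P \<union> B" "R a b" for a b
      using that \<sigma>(4) \<tau>(2) by simp
    show "Defs.degree R a \<le> T" if "a < n" "a \<notin> P \<union> B" for a
      using that by (auto simp: B_def)
  qed
  then show ?thesis by (auto simp: conflicts_def)
qed

end

section \<open>The extremal graph\<close>

definition co_graph :: "nat \<Rightarrow> (nat \<Rightarrow> nat \<Rightarrow> bool) \<Rightarrow> nat \<Rightarrow> nat \<Rightarrow> bool" where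
  "co_graph n G i j \<longleftrightarrow> i < n \<and> j < n \<and> i \<noteq> j \<and> \<not> G i j"

lemma simple_co_graph: "simple_graph n G \<Longrightarrow> simple_graph n (co_graph n G)"
  unfolding simple_graph_def co_graph_def by blast

lemma degree_co_graph:
  assumes G: "simple_graph n G" and i: "i < n"
  shows "Defs.degree G i + Defs.degree (co_graph n G) i = n - 1"
proof -
  have "card ({..<n} - {i}) = card (nbhd G i \<union> nbhd (co_graph n G) i)"
    by (rule arg_cong[where f = card])
       (use simple_graphD(1,2)[OF G] simple_graph_irrefl[OF G] i in \<open>auto simp: co_graph_def\<close>)
  also have "\<dots> = card (nbhd G i) + card (nbhd (co_graph n G) i)"
    using finite_nbhd[OF G] finite_nbhd[OF simple_co_graph[OF G]]
    by (intro card_Un_disjoint) (auto simp: co_graph_def)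
  finally show ?thesis using i by (simp add: Defs.degree_def)
qed

text \<open>The inverse of the packing is the embedding: an edge of \<open>F\<close> pulled back to
  a non-edge of \<open>G\<close> would be a conflict.\<close>

lemma contains_subgraph_of_packing:
  assumes F: "simple_graph n F" and \<sigma>: "bij_betw \<sigma> {..<n} {..<n}"
    and pack: "\<And>a b. co_graph n G a b \<Longrightarrow> \<not> F (\<sigma> a) (\<sigma> b)"
  shows "contains_subgraph n G n F"
proof -
  let ?f = "inv_into {..<n} \<sigma>"
  have f: "bij_betw ?f {..<n} {..<n}" using \<sigma> by (rule bij_betw_inv_into)
  have "G (?f i) (?f j)" if ij: "F i j" for i j
  proof (rule ccontr)
    assume no: "\<not> G (?f i) (?f j)"
    note s = simple_graphD[OF F ij]
    have "?f i < n" "?f j < n" using f s by (auto dest: bij_betwE)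
    moreover have si: "\<sigma> (?f i) = i" "\<sigma> (?f j) = j"
      using \<sigma> s by (auto simp: bij_betw_inv_into_right)
    moreover have "?f i \<noteq> ?f j" using si s(3) by metis
    ultimately have "co_graph n G (?f i) (?f j)" using no by (simp add: co_graph_def)
    then show False using pack[of "?f i" "?f j"] si ij by simp
  qed
  then show ?thesis
    unfolding contains_subgraph_def using f by (intro exI[of _ ?f]) (auto simp: bij_betw_def)
qed

section \<open>Counting missing edges at a vertex and away from it\<close>

definition edges_avoiding :: "(nat \<Rightarrow> nat \<Rightarrow> bool) \<Rightarrow> nat \<Rightarrow> (nat \<times> nat) set" where
  "edges_avoiding R v = {(i, j). R i j \<and> i < j \<and> i \<noteq> v \<and> j \<noteq> v}"

lemma finite_edges_avoiding:
  "simple_graph n R \<Longrightarrow> finite (edges_avoiding R v)"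
  by (rule finite_subset[OF _ finite_arcs]) (auto simp: edges_avoiding_def arcs_def)

lemma card_arcs_avoiding:
  assumes R: "simple_graph n R"
  shows "card {(i, j). R i j \<and> i \<noteq> v \<and> j \<noteq> v} = 2 * card (edges_avoiding R v)"
proof -
  have "{(i, j). R i j \<and> i \<noteq> v \<and> j \<noteq> v} =
      edges_avoiding R v \<union> prod.swap ` edges_avoiding R v"
    using simple_graphD(3,4)[OF R] by (fastforce simp: edges_avoiding_def image_iff neq_iff)
  moreover have "edges_avoiding R v \<inter> prod.swap ` edges_avoiding R v = {}"
    by (auto simp: edges_avoiding_def)
  ultimately show ?thesis
    using finite_edges_avoiding[OF R, of v]
    by (simp add: card_Un_disjoint card_image)
qed

lemma sum_degree_eq:
  assumes R: "simple_graph n R"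
  shows "(\<Sum>i<n. Defs.degree R i) = 2 * Defs.degree R v + 2 * card (edges_avoiding R v)"
proof -
  let ?I = "{(i, j). R i j \<and> i \<noteq> v \<and> j \<noteq> v}"
  let ?V = "Pair v ` nbhd R v" and ?W = "(\<lambda>j. (j, v)) ` nbhd R v"
  have "(\<Sum>i<n. Defs.degree R i) = card (arcs R)"
    using sum_arcs[OF R, of "\<lambda>i j. 1 :: nat"] by (simp add: Defs.degree_def)
  also have "arcs R = (?V \<union> ?W) \<union> ?I"
    using simple_graphD(4)[OF R] by (auto simp: arcs_def)
  also have "card \<dots> = card (?V \<union> ?W) + card ?I"
    using finite_nbhd[OF R, of v] finite_arcs[OF R]
    by (intro card_Un_disjoint) (auto simp: arcs_def intro: finite_subset[rotated])
  also have "card (?V \<union> ?W) = card ?V + card ?W"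
    using finite_nbhd[OF R, of v] simple_graphD(3)[OF R] by (intro card_Un_disjoint) auto
  also have "card ?V = Defs.degree R v"
    by (simp add: card_image inj_on_def Defs.degree_def)
  also have "card ?W = Defs.degree R v"
    by (simp add: card_image inj_on_def Defs.degree_def)
  finally show ?thesis using card_arcs_avoiding[OF R] by simp
qed

text \<open>At most one edge at \<open>a\<close> goes to \<open>v\<close>; ordering the ends of the
  others injects them into \<open>edges_avoiding R v\<close>.\<close>

lemma degree_le_edges_avoiding:
  assumes R: "simple_graph n R" and "a \<noteq> v"
  shows "Defs.degree R a \<le> card (edges_avoiding R v) + 1"
proof -
  have "card (nbhd R a - {v}) \<le> card (edges_avoiding R v)"
  proof (rule card_inj_on_le[of "\<lambda>j. (min a j, max a j)"])
    show "inj_on (\<lambda>j. (min a j, max a j)) (nbhd R a - {v})"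
      by (auto simp: inj_on_def min_def max_def split: if_splits)
    show "(\<lambda>j. (min a j, max a j)) ` (nbhd R a - {v}) \<subseteq> edges_avoiding R v"
      using simple_graphD(3,4)[OF R] \<open>a \<noteq> v\<close>
      by (fastforce simp: edges_avoiding_def min_def max_def neq_iff)
  qed (rule finite_edges_avoiding[OF R])
  moreover have "card (nbhd R a) \<le> card (nbhd R a - {v}) + 1"
    using card_Diff1_le card_Suc_Diff1[OF finite_nbhd[OF R]] by (cases "v \<in> nbhd R a") auto
  ultimately show ?thesis by (simp add: Defs.degree_def)
qed

text \<open>The difference of n(n - 1) and the lower bound n(n - 3) for the degree sum of
  \<open>G\<close> is 2n.\<close>

lemma sum_degree_co_graph_le:
  assumes G: "simple_graph n G" and n: "3 \<le> n" and q: "2 * real n - 4 \<le> q_index n G"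
  shows "(\<Sum>i<n. Defs.degree (co_graph n G) i) \<le> 2 * n"
proof -
  have "(\<Sum>i<n. Defs.degree G i) + (\<Sum>i<n. Defs.degree (co_graph n G) i) = n * (n - 1)"
    unfolding sum.distrib[symmetric] using degree_co_graph[OF G] by simp
  then have "(\<Sum>i<n. real (Defs.degree G i)) + real (\<Sum>i<n. Defs.degree (co_graph n G) i) = real n * (real n - 1)"
    using n by (simp flip: of_nat_sum of_nat_add add: of_nat_diff)
  then have "real (\<Sum>i<n. Defs.degree (co_graph n G) i) \<le> real (2 * n)"
    using degree_sum_ge[OF G n q] by (simp add: algebra_simps)
  then show ?thesis by (simp only: of_nat_le_iff)
qed

text \<open>Place \<open>u\<close> at \<open>v\<close> and the neighbours of \<open>u\<close> on a clique of \<open>G\<close> among the neighbours of \<open>v\<close>;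
  the clique is what remains after deleting one endpoint of every missing edge.\<close>
lemma (in sparse_pair) packing_of_star:
  assumes n: "2500 \<le> n" and D: "1600 * D\<^sup>2 \<le> n"
    and G: "simple_graph n G" and RG: "R = co_graph n G"
    and v: "v < n" and dv: "5 * Defs.degree G v + 6 \<le> n"
    and u: "u < n" and r: "card (edges_avoiding R v) + Defs.degree F u \<le> Defs.degree G v"
  shows "\<exists>\<sigma>. bij_betw \<sigma> {..<n} {..<n} \<and> (\<forall>a b. R a b \<longrightarrow> \<not> F (\<sigma> a) (\<sigma> b))"
proof -
  let ?U = "edges_avoiding R v"
  have "card (nbhd G v) - card (fst ` ?U) \<le> card (nbhd G v - fst ` ?U)"
    using finite_edges_avoiding[OF R] by (intro diff_card_le_card_Diff) simp
  moreover have "card (fst ` ?U) \<le> card ?U"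
    using finite_edges_avoiding[OF R] by (rule card_image_le)
  ultimately have "Defs.degree F u \<le> card (nbhd G v - fst ` ?U)"
    using r by (simp add: Defs.degree_def)
  then obtain S where S: "S \<subseteq> nbhd G v - fst ` ?U" "card S = Defs.degree F u" "finite S"
    by (rule obtain_subset_with_card_n)
  have Sn: "S \<subseteq> {..<n}" and vS: "v \<notin> S"
    using S(1) nbhd_subset[OF G] simple_graph_irrefl[OF G] by auto
  obtain h where h: "bij_betw h S (nbhd F u)"
    using finite_same_card_bij[of S "nbhd F u"] S finite_nbhd[OF F] by (auto simp: Defs.degree_def)
  define \<sigma>\<^sub>0 where "\<sigma>\<^sub>0 a = (if a = v then u else h a)" for a
  have im: "\<sigma>\<^sub>0 ` S = nbhd F u"
    using h vS by (auto simp: \<sigma>\<^sub>0_def bij_betw_def image_iff)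
  have v_S: "\<not> R v s" "\<not> R s v" if "s \<in> S" for s
    using that S(1) simple_graphD(4)[OF G] by (auto simp: RG co_graph_def)
  have S_S: "\<not> R s t" if st: "s \<in> S" "t \<in> S" for s t
  proof
    assume "R s t"
    moreover have "s \<noteq> v" "t \<noteq> v" using st vS by auto
    moreover have "s \<noteq> t" "R t s" using simple_graphD(3,4)[OF R \<open>R s t\<close>] by auto
    ultimately have "(s, t) \<in> ?U \<or> (t, s) \<in> ?U"
      by (auto simp: edges_avoiding_def)
    then show False using S(1) st by force
  qed
  have sumS: "(\<Sum>s\<in>S. Defs.degree R s) \<le> 2 * card ?U"
  proof -
    have "(\<Sum>s\<in>S. Defs.degree R s) = card (Sigma S (nbhd R))"
      using S(3) finite_nbhd[OF R] by (simp add: Defs.degree_def)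
    also have "\<dots> \<le> card {(i, j). R i j \<and> i \<noteq> v \<and> j \<noteq> v}"
      using v_S vS finite_arcs[OF R]
      by (intro card_mono) (auto simp: arcs_def intro: finite_subset[rotated])
    finally show ?thesis using card_arcs_avoiding[OF R] by simp
  qed
  have rd: "card ?U \<le> Defs.degree G v + 1"
    using sum_degree_R sum_degree_eq[OF R, of v] degree_co_graph[OF G v] by (simp add: RG)
  show ?thesis
  proof (rule packing_extends[OF n D, of "insert v S" \<sigma>\<^sub>0 "2 * card ?U" "card ?U + 1"])
    show "insert v S \<subseteq> {..<n}" using v Sn by simp
    have "inj_on \<sigma>\<^sub>0 S" using h vS by (auto simp: \<sigma>\<^sub>0_def bij_betw_def inj_on_def)
    moreover have "\<sigma>\<^sub>0 v \<notin> \<sigma>\<^sub>0 ` S"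
      unfolding im using simple_graphD(3)[OF F] by (auto simp: \<sigma>\<^sub>0_def)
    ultimately show "inj_on \<sigma>\<^sub>0 (insert v S)" using vS by auto
    show "\<sigma>\<^sub>0 ` insert v S \<subseteq> {..<n}"
      using im u nbhd_subset[OF F] by (auto simp: \<sigma>\<^sub>0_def)
    show "card (insert v S) \<le> D + 1" using S vS degree_F[of u] by simp
    show "\<not> F (\<sigma>\<^sub>0 a) (\<sigma>\<^sub>0 b)" if "a \<in> insert v S" "b \<in> insert v S" "R a b" for a b
      using that v_S S_S simple_graphD(3)[OF R] by blast
    \<comment> \<open>The huge degree of \<open>v\<close> in \<open>R\<close> loads only the
      neighbours of \<open>u\<close>. These are exactly the images of \<open>S\<close>, hence
      exempt, and only the degrees of \<open>S\<close> count.\<close>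
    show "load \<sigma>\<^sub>0 (insert v S) w \<le> 2 * card ?U" if w: "w \<notin> \<sigma>\<^sub>0 ` insert v S" for w
    proof -
      have "\<not> F w (\<sigma>\<^sub>0 v)" using w im F_sym by (auto simp: \<sigma>\<^sub>0_def)
      then have "load \<sigma>\<^sub>0 (insert v S) w \<le> (\<Sum>s\<in>S. Defs.degree R s)"
        unfolding load_def using S(3) by (intro sum_mono2) auto
      then show ?thesis using sumS by linarith
    qed
    show "Defs.degree R a \<le> card ?U + 1" if "a < n" "a \<notin> insert v S" for a
      using that by (intro degree_le_edges_avoiding[OF R]) auto
    show "5 * (2 * card ?U + (card ?U + 1)) \<le> 4 * n" using rd dv n by simp
  qed
qed

text \<open>Passing to the pendant clique gains two arcs for each missing edge avoiding
  \<open>v\<close> and loses at most two for each neighbour of \<open>v\<close> outside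
  \<open>S\<close>; hypothesis \<open>r\<close> compares these counts.\<close>

lemma q_index_less_of_missing_edges:
  assumes G: "simple_graph n G" and n: "200 \<le> n" and v: "v < n"
    and dv: "5 * Defs.degree G v + 6 \<le> n"
    and S: "S \<subseteq> nbhd G v" "card S < Defs.degree G v"
    and r: "Defs.degree G v \<le> card (edges_avoiding (co_graph n G) v) + card S"
    and sum: "(\<Sum>i<n. Defs.degree (co_graph n G) i) \<le> 2 * n"
    and q: "2 * real n - 4 \<le> q_index n G"
  shows "q_index n G < q_index n (pendant_clique n v S)"
proof (rule q_index_less_pendant_clique[OF G v n S(1) _ _ _ _ q])
  let ?R = "co_graph n G" and ?K = "pendant_clique n v S"
  note R = simple_co_graph[OF G]
  have rd: "card (edges_avoiding ?R v) \<le> Defs.degree G v + 1"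
    using sum sum_degree_eq[OF R, of v] degree_co_graph[OF G v] by simp
  have finS: "finite S" using S(1) finite_nbhd[OF G] by (rule finite_subset)
  show "5 * Defs.degree G v \<le> n" using dv by simp
  show "4 / 5 * real n - 2 \<le> real (Defs.degree G w)" if w: "w < n" "w \<noteq> v" for w
    using degree_le_edges_avoiding[OF R w(2)] degree_co_graph[OF G w(1)] rd dv by linarith
  have "arcs ?K - arcs G = {(i, j). ?R i j \<and> i \<noteq> v \<and> j \<noteq> v}"
    using S(1) simple_graphD(4)[OF G] by (auto simp: arcs_def pendant_clique_def co_graph_def)
  then have KG: "card (arcs ?K - arcs G) = 2 * card (edges_avoiding ?R v)"
    using card_arcs_avoiding[OF R] by simp
  let ?N = "nbhd G v - S"
  have N: "card ?N = Defs.degree G v - card S" "finite ?N"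
    using card_Diff_subset[OF finS S(1)] finite_nbhd[OF G] by (auto simp: Defs.degree_def)
  have "arcs G - arcs ?K \<subseteq> Pair v ` ?N \<union> (\<lambda>j. (j, v)) ` ?N"
    using simple_graphD(1,2,4)[OF G] simple_graph_irrefl[OF G]
    by (auto simp: arcs_def pendant_clique_def)
  then have "card (arcs G - arcs ?K) \<le> card (Pair v ` ?N \<union> (\<lambda>j. (j, v)) ` ?N)"
    using N by (intro card_mono) auto
  also have "\<dots> \<le> card (Pair v ` ?N) + card ((\<lambda>j. (j, v)) ` ?N)"
    by (rule card_Un_le)
  also have "\<dots> \<le> card ?N + card ?N"
    using N by (intro add_mono card_image_le) auto
  also have "\<dots> \<le> card (arcs ?K - arcs G)"
    unfolding KG N using r by linarith
  finally show "card (arcs G - arcs ?K) \<le> card (arcs ?K - arcs G)" .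
  have "0 < card (arcs ?K - arcs G)" unfolding KG using r S(2) by linarith
  then show "arcs ?K - arcs G \<noteq> {}" by force
qed

text \<open>Inequality and equality case in one: isomorphic graphs have equal q, so this also rules
  out a strict excess of \<open>G\<close>.\<close>

lemma extremal_graph_iso:
  assumes n: "2500 \<le> n" and F: "simple_graph n F" "no_isolated_vertices n F"
    and \<Delta>: "real (max_degree n F) \<le> sqrt (real n) / 40"
    and G: "simple_graph n G" and free: "\<not> contains_subgraph n G n F"
    and q: "q_index n (H_graph n (min_degree n F)) \<le> q_index n G"
  shows "graph_iso n G (H_graph n (min_degree n F))"
proof -
  define D where "D = max_degree n F"
  define k where "k = min_degree n F"
  define R where "R = co_graph n G"
  let ?H = "H_graph n k"
  have R: "simple_graph n R" unfolding R_def by (rule simple_co_graph[OF G])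
  have dF: "Defs.degree F i \<le> D" for i
  proof (cases "i < n")
    case True
    then show ?thesis unfolding D_def max_degree_def by (intro Max_ge) auto
  next
    case False
    then have "nbhd F i = {}" using simple_graphD(1)[OF F(1)] by blast
    then show ?thesis by (simp add: Defs.degree_def)
  qed
  have D: "1600 * D\<^sup>2 \<le> n"
  proof -
    have "(40 * real D)\<^sup>2 \<le> (sqrt (real n))\<^sup>2"
      using \<Delta> by (intro power_mono) (auto simp: D_def)
    then have "real (1600 * D\<^sup>2) \<le> real n" by (simp add: power_mult_distrib)
    then show ?thesis by (simp only: of_nat_le_iff)
  qed
  have "k \<in> Defs.degree F ` {..<n}"
    unfolding k_def min_degree_def using n by (intro Min_in) (auto simp: lessThan_empty_iff)
  then obtain u where u: "u < n" "Defs.degree F u = k" by auto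
  have "nbhd F u \<noteq> {}" using F(2) u(1) by (auto simp: no_isolated_vertices_def)
  \<comment> \<open>Makes the truncated \<open>k - 1\<close> a genuine subtraction.\<close>
  then have k1: "1 \<le> k"
    using u(2) finite_nbhd[OF F(1), of u] by (auto simp: Defs.degree_def Suc_le_eq card_gt_0_iff)
  have kn: "k \<le> n - 1" using degree_le[OF F(1), of u] u(2) by simp
  have qK: "q_index n (pendant_clique n v S) = q_index n ?H" "graph_iso n (pendant_clique n v S) ?H"
    if "v < n" "S \<subseteq> {..<n} - {v}" "card S = k - 1" for v S
    using graph_iso_pendant_clique[OF that] n
    by (auto intro!: q_index_iso simple_graph_pendant_clique simple_graph_H_graph)
  have "{..<k - 1} \<subseteq> {..<n} - {n - 1}" using k1 kn by auto
  then have "2 * real n - 4 \<le> q_index n ?H"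
    using qK(1)[of "n - 1" "{..<k - 1}"] q_index_pendant_clique_ge[of "n - 1" n "{..<k - 1}"] n
    by simp
  then have qG: "2 * real n - 4 \<le> q_index n G" using q by (simp add: k_def)
  have sumR: "(\<Sum>i<n. Defs.degree R i) \<le> 2 * n"
    unfolding R_def using sum_degree_co_graph_le[OF G _ qG] n by simp
  interpret sparse_pair n R F D
    using R F(1) dF sumR by unfold_locales
  have no_packing: "\<not> (\<exists>\<sigma>. bij_betw \<sigma> {..<n} {..<n} \<and> (\<forall>a b. R a b \<longrightarrow> \<not> F (\<sigma> a) (\<sigma> b)))"
    using contains_subgraph_of_packing[OF F(1)] free unfolding R_def by blast
  have "\<exists>a<n. 4 * n < 5 * Defs.degree R a"
  proof (rule ccontr)
    assume "\<not> ?thesis"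
    then have "5 * Defs.degree R a \<le> 4 * n" if "a < n" for a
      using that by (meson not_less)
    then have le: "Defs.degree R a \<le> 4 * n div 5" if "a < n" for a
      using that by (simp add: less_eq_div_iff_mult_less_eq mult.commute)
    \<comment> \<open>Nothing needs to be placed in advance, so the whole allowance of
      \<open>4n/5\<close> goes to the maximum degree of \<open>R\<close>.\<close>
    have "\<exists>\<sigma>. bij_betw \<sigma> {..<n} {..<n} \<and> (\<forall>a b. R a b \<longrightarrow> \<not> F (\<sigma> a) (\<sigma> b))"
      by (rule packing_extends[OF n D, of "{}" id 0 "4 * n div 5"])
         (use le in \<open>auto simp: load_def\<close>)
    then show False using no_packing by blast
  qed
  then obtain v where v: "v < n" "4 * n < 5 * Defs.degree R v" by blast
  have dGR: "Defs.degree G v + Defs.degree R v = n - 1"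
    unfolding R_def by (rule degree_co_graph[OF G v(1)])
  have dv: "5 * Defs.degree G v + 6 \<le> n" using v dGR by linarith
  have Nv: "nbhd G v \<subseteq> {..<n} - {v}"
    using nbhd_subset[OF G] simple_graphD(3)[OF G] by blast
  show ?thesis
  proof (cases "Defs.degree G v < k")
    case True
    have "card (nbhd G v) \<le> k - 1" using True by (simp add: Defs.degree_def)
    moreover have "k - 1 \<le> card ({..<n} - {v})" using kn v(1) by simp
    \<comment> \<open>Padding the neighbourhood of \<open>v\<close> to \<open>k - 1\<close> vertices
      puts \<open>G\<close> inside a copy of the extremal graph.\<close>
    ultimately obtain S where S: "nbhd G v \<subseteq> S" "S \<subseteq> {..<n} - {v}" "card S = k - 1"
      using exists_subset_between[of "nbhd G v" "k - 1" "{..<n} - {v}"] Nv by auto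
    have "G = pendant_clique n v S"
    proof (rule subgraph_pendant_clique_eq[OF G v(1) S(2)])
      show "real (card S) < 2 * real n - 4" using S(3) kn n by simp
      show "pendant_clique n v S i j" if "G i j" for i j
        using simple_graphD[OF G that] that S(1) by (auto simp: pendant_clique_def)
      show "q_index n (pendant_clique n v S) \<le> q_index n G"
        using q qK(1)[OF v(1) S(2,3)] by (simp add: k_def)
    qed
    then show ?thesis using qK(2)[OF v(1) S(2,3)] by (simp add: k_def)
  next
    case False
    have "\<not> card (edges_avoiding R v) + Defs.degree F u \<le> Defs.degree G v"
      using packing_of_star[OF n D G R_def v(1) dv u(1)] no_packing by blast
    then have r: "Defs.degree G v < card (edges_avoiding R v) + k" using u(2) by simp
    have "k - 1 \<le> card (nbhd G v)" using False by (simp add: Defs.degree_def)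
    \<comment> \<open>Keeping only \<open>k - 1\<close> neighbours of \<open>v\<close> deletes at
      most as many edges as are missing away from \<open>v\<close>.\<close>
    then obtain S where S: "S \<subseteq> nbhd G v" "card S = k - 1"
      by (rule obtain_subset_with_card_n)
    have "q_index n G < q_index n (pendant_clique n v S)"
    proof (rule q_index_less_of_missing_edges[OF G _ v(1) dv S(1) _ _ _ qG])
      show "200 \<le> n" using n by simp
      show "card S < Defs.degree G v" using S(2) False k1 by simp
      show "Defs.degree G v \<le> card (edges_avoiding (co_graph n G) v) + card S"
        using r S(2) k1 by (simp add: R_def)
      show "(\<Sum>i<n. Defs.degree (co_graph n G) i) \<le> 2 * n"
        using sumR by (simp add: R_def)
    qed
    moreover have "q_index n (pendant_clique n v S) = q_index n ?H"
      using qK(1)[OF v(1) _ S(2)] S(1) Nv by blast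
    ultimately show ?thesis using q by (simp add: k_def)
  qed
qed

theorem theorem1p7:
  "\<exists>n0::nat. \<forall>n \<ge> n0. \<forall>F G.
     simple_graph n F \<longrightarrow> no_isolated_vertices n F \<longrightarrow>
     real (max_degree n F) \<le> sqrt (real n) / 40 \<longrightarrow>
     simple_graph n G \<longrightarrow> \<not> contains_subgraph n G n F \<longrightarrow>
     q_index n G \<le> q_index n (H_graph n (min_degree n F)) \<and>
     (q_index n G = q_index n (H_graph n (min_degree n F)) \<longleftrightarrow>
        graph_iso n G (H_graph n (min_degree n F)))"
proof (intro exI[of _ "2500 :: nat"] allI impI)
  fix n :: nat and F G
  assume n: "2500 \<le> n" and "simple_graph n F" "no_isolated_vertices n F"
    "real (max_degree n F) \<le> sqrt (real n) / 40"
    and G: "simple_graph n G" and "\<not> contains_subgraph n G n F"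
  then have iso: "q_index n (H_graph n (min_degree n F)) \<le> q_index n G \<Longrightarrow>
      graph_iso n G (H_graph n (min_degree n F))"
    by (intro extremal_graph_iso)
  have eq: "graph_iso n G (H_graph n (min_degree n F)) \<Longrightarrow>
      q_index n G = q_index n (H_graph n (min_degree n F))"
    using n by (intro q_index_iso[OF G simple_graph_H_graph]) auto
  show "q_index n G \<le> q_index n (H_graph n (min_degree n F)) \<and>
     (q_index n G = q_index n (H_graph n (min_degree n F)) \<longleftrightarrow>
        graph_iso n G (H_graph n (min_degree n F)))"
    using iso eq by force
qed

end
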